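(* Suppose that $\mathrm{rank}(\mathbf{H}_{qq})=n_{T_q}$ for all $q\in\Omega$. For each $q\in\Omega$ and $r\ne q$, let $\mathbf{P}_{rq}^\star$ be (the $\mathbf{P}_{rq}$-component of) a solution of $$\begin{array}{ll}\underset{\mathbf{P}_{rq}\in\mathbb{C}^{n_{R_q}\times n_{R_q}},\ \mathbf{Q}_{-q}\in\mathscr{Q}_{-q}}{\text{maximize}} & \rho\big(\mathbf{H}_{rq}^H\mathbf{P}_{rq}^H\mathbf{H}_{qq}^{\sharp H}\mathbf{H}_{qq}^{\sharp}\mathbf{P}_{rq}\mathbf{H}_{rq}\big)\\ \text{subject to} & \mathbf{P}_{rq}=\mathbf{P}_{rq}^2,\quad \mathcal{R}(\mathbf{P}_{rq})=\mathcal{R}(\mathbf{H}_{qq}),\quad \mathcal{N}(\mathbf{P}_{rq})=\mathcal{N}\big(\mathbf{H}_{qq}^H\mathbf{R}_{-q}^{-1}(\mathbf{Q}_{-q})\big),\end{array}$$ and let $\mathscr{P}^\star=(\mathbf{P}_{rq}^\star)_{r\neq q}$. Then for any $\mathbf{w}=[w_1,\ldots,w_Q]^T>\mathbf{0}$ the multiuser waterfilling mapping $\mathbf{WF}:\mathscr{Q}\to\mathscr{Q}$ is Lipschitz continuous on $\mathscr{Q}$: $$\big\|\mathbf{WF}(\mathbf{Q}^{(1)})-\mathbf{WF}(\mathbf{Q}^{(2)})\big\|_{F,\mathrm{block}}^{\mathbf{w}}\le\|\mathbf{S}(\mathscr{P}^\star)\|_{\infty,\mathrm{mat}}^{\mathbf{w}}\,\big\|\mathbf{Q}^{(1)}-\mathbf{Q}^{(2)}\big\|_{F,\mathrm{block}}^{\mathbf{w}}\qquad\forall\,\mathbf{Q}^{(1)},\mathbf{Q}^{(2)}\in\mathscr{Q}.$$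 Furthermore, if $\|\mathbf{S}(\mathscr{P}^\star)\|_{\infty,\mathrm{mat}}^{\mathbf{w}}<1$ for some $\mathbf{w}>\mathbf{0}$, then $\mathbf{WF}$ is a block-contraction with modulus $\beta=\|\mathbf{S}(\mathscr{P}^\star)\|_{\infty,\mathrm{mat}}^{\mathbf{w}}$ (that is, a contraction with modulus $\beta$ with respect to $\|\cdot\|_{F,\mathrm{block}}^{\mathbf{w}}$).
   Context: Setting. $\Omega=\{1,\ldots,Q\}$. For $r,q\in\Omega$, $\mathbf{H}_{rq}\in\mathbb{C}^{n_{R_q}\times n_{T_r}}$, $\mathbf{R}_{n_q}\in\mathbb{C}^{n_{R_q}\times n_{R_q}}$ is Hermitian positive definite, and $P_q>0$. The strategy sets are $\mathscr{Q}_q=\{\mathbf{Q}\in\mathbb{C}^{n_{T_q}\times n_{T_q}}:\mathbf{Q}\succeq\mathbf{0},\ \mathrm{Tr}(\mathbf{Q})=P_q\}$, $\mathscr{Q}=\mathscr{Q}_1\times\cdots\times\mathscr{Q}_Q$, $\mathscr{Q}_{-q}=\prod_{r\ne q}\mathscr{Q}_r$, and for $\mathbf{Q}_{-q}=(\mathbf{Q}_r)_{r\neq q}\in\mathscr{Q}_{-q}$, $\mathbf{R}_{-q}(\mathbf{Q}_{-q})=\mathbf{R}_{n_q}+\sum_{r\neq q}\mathbf{H}_{rq}\mathbf{Q}_r\mathbf{H}_{rq}^H$. Waterfilling mapping. Write the reduced eigendecomposition $\mathbf{H}_{qq}^H\mathbf{R}_{-q}^{-1}(\mathbf{Q}_{-q})\mathbf{H}_{qq}=\mathbf{U}_q\mathbf{D}_q\mathbf{U}_q^H$,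 with $\mathbf{U}_q\in\mathbb{C}^{n_{T_q}\times r_q}$ having orthonormal columns, $\mathbf{D}_q$ an $r_q\times r_q$ diagonal matrix with positive diagonal entries, $r_q=\mathrm{rank}(\mathbf{H}_{qq})$. Then $\mathbf{WF}_q(\mathbf{Q}_{-q})=\mathbf{U}_q(\mu_q\mathbf{I}-\mathbf{D}_q^{-1})^+\mathbf{U}_q^H$, where $(\cdot)^+=\max(0,\cdot)$ acts on the diagonal entries and $\mu_q$ is chosen so that $\mathrm{Tr}\{(\mu_q\mathbf{I}-\mathbf{D}_q^{-1})^+\}=P_q$; and $\mathbf{WF}(\mathbf{Q})=(\mathbf{WF}_q(\mathbf{Q}_{-q}))_{q\in\Omega}$. Norms. For a tuple $\mathbf{X}=(\mathbf{X}_q)_{q\in\Omega}$, $\|\mathbf{X}\|_{F,\mathrm{block}}^{\mathbf{w}}=\max_{q}\|\mathbf{X}_q\|_F/w_q$ with $\|\cdot\|_F$ the Frobenius norm. For $\mathbf{A}\in\mathbb{R}^{Q\times Q}$, $\|\mathbf{A}\|_{\infty,\mathrm{mat}}^{\mathbf{w}}=\max_q\frac{1}{w_q}\sum_{r=1}^Q|[\mathbf{A}]_{qr}|w_r$. Vector inequalities are componentwise. For $\mathscr{P}=(\mathbf{P}_{rq})_{r\neq q}$ with $\mathbf{P}_{rq}\in\mathbb{C}^{n_{R_q}\times n_{R_q}}$, the matrix $\mathbf{S}(\mathscr{P})\in\mathbb{R}_+^{Q\times Q}$ is given by $[\mathbf{S}(\mathscr{P})]_{qr}=\rho\big(\mathbf{H}_{rq}^H\mathbf{P}_{rq}^H\mathbf{H}_{qq}^{\sharp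 H}\mathbf{H}_{qq}^{\sharp}\mathbf{P}_{rq}\mathbf{H}_{rq}\big)$ if $r\neq q$ and $[\mathbf{S}(\mathscr{P})]_{qq}=0$. Here $\rho$ is the spectral radius, $(\cdot)^\sharp$ the Moore-Penrose pseudoinverse, $\mathbf{A}^{\sharp H}=(\mathbf{A}^\sharp)^H$, and $\mathcal{R}(\cdot)$, $\mathcal{N}(\cdot)$ denote range and null space. *)

theory Defs
  imports
    "Jordan_Normal_Form.Spectral_Radius"
    "Jordan_Normal_Form.Schur_Decomposition"
    "Jordan_Normal_Form.Gauss_Jordan_Elimination"
    "Jordan_Normal_Form.Matrix_Kernel"
    "Jordan_Normal_Form.DL_Rank"
    "HOL-Library.FuncSet"
begin

definition hermitian_mat :: "complex mat \<Rightarrow> bool" where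
  "hermitian_mat A \<longleftrightarrow> A \<in> carrier_mat (dim_row A) (dim_row A) \<and> mat_adjoint A = A"

definition psd_mat :: "complex mat \<Rightarrow> bool" where
  "psd_mat A \<longleftrightarrow> hermitian_mat A \<and>
     (\<forall>v \<in> carrier_vec (dim_row A). 0 \<le> Re ((A *\<^sub>v v) \<bullet>c v))"

definition pd_mat :: "complex mat \<Rightarrow> bool" where
  "pd_mat A \<longleftrightarrow> hermitian_mat A \<and>
     (\<forall>v \<in> carrier_vec (dim_row A). v \<noteq> 0\<^sub>v (dim_row A) \<longrightarrow> 0 < Re ((A *\<^sub>v v) \<bullet>c v))"

definition mat_tr :: "complex mat \<Rightarrow> complex" where
  "mat_tr A = (\<Sum>i<dim_row A. A $$ (i, i))"

definition frob_norm :: "complex mat \<Rightarrow> real" where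
  "frob_norm A = sqrt (\<Sum>i<dim_row A. \<Sum>j<dim_col A. (cmod (A $$ (i, j)))\<^sup>2)"

definition mat_inv :: "complex mat \<Rightarrow> complex mat" where
  "mat_inv A = the (mat_inverse A)"

definition is_pseudoinverse :: "complex mat \<Rightarrow> complex mat \<Rightarrow> bool" where
  "is_pseudoinverse A X \<longleftrightarrow> X \<in> carrier_mat (dim_col A) (dim_row A) \<and>
     A * X * A = A \<and> X * A * X = X \<and>
     mat_adjoint (A * X) = A * X \<and> mat_adjoint (X * A) = X * A"

definition pinv :: "complex mat \<Rightarrow> complex mat" where
  "pinv A = (THE X. is_pseudoinverse A X)"

definition mat_rank :: "complex mat \<Rightarrow> nat" where
  "mat_rank A = vec_space.rank (dim_row A) A"

definition mat_range :: "complex mat \<Rightarrow> complex vec set" where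
  "mat_range A = {A *\<^sub>v v | v. v \<in> carrier_vec (dim_col A)}"

text \<open>Tuples indexed by the players \<open>{1..Q}\<close> are functions on \<open>nat\<close>; a real \<open>Q \<times> Q\<close> matrix is a
  function of two player indices (row first). Only values at indices in \<open>{1..Q}\<close> matter.\<close>

definition block_norm :: "nat \<Rightarrow> (nat \<Rightarrow> real) \<Rightarrow> (nat \<Rightarrow> complex mat) \<Rightarrow> real" where
  "block_norm Q w X = Max ((\<lambda>q. frob_norm (X q) / w q) ` {1..Q})"

definition inf_mat_norm :: "nat \<Rightarrow> (nat \<Rightarrow> real) \<Rightarrow> (nat \<Rightarrow> nat \<Rightarrow> real) \<Rightarrow> real" where
  "inf_mat_norm Q w A = Max ((\<lambda>q. (1 / w q) * (\<Sum>r = 1..Q. \<bar>A q r\<bar> * w r)) ` {1..Q})"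

definition block_contraction_on ::
  "nat \<Rightarrow> (nat \<Rightarrow> real) \<Rightarrow> (nat \<Rightarrow> complex mat) set \<Rightarrow>
   ((nat \<Rightarrow> complex mat) \<Rightarrow> nat \<Rightarrow> complex mat) \<Rightarrow> real \<Rightarrow> bool" where
  "block_contraction_on Q w S T \<beta> \<longleftrightarrow> T \<in> S \<rightarrow> S \<and> 0 \<le> \<beta> \<and> \<beta> < 1 \<and>
     (\<forall>X \<in> S. \<forall>Y \<in> S.
        block_norm Q w (\<lambda>q. T X q - T Y q) \<le> \<beta> * block_norm Q w (\<lambda>q. X q - Y q))"

text \<open>Parameters: \<open>Q\<close> is the number of players, \<open>nT\<close> and \<open>nR\<close> the numbers of transmit and receive
  antennas, \<open>H r q\<close> the channel from transmitter \<open>r\<close> to receiver \<open>q\<close>, \<open>Rn q\<close> the noise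
  covariance and \<open>pw q\<close> the power budget.\<close>

definition strategies :: "nat \<Rightarrow> real \<Rightarrow> complex mat set" where
  "strategies n p = {X \<in> carrier_mat n n. psd_mat X \<and> mat_tr X = complex_of_real p}"

definition joint_strategies ::
  "nat \<Rightarrow> (nat \<Rightarrow> nat) \<Rightarrow> (nat \<Rightarrow> real) \<Rightarrow> (nat \<Rightarrow> complex mat) set" where
  "joint_strategies Q nT pw = (\<Pi>\<^sub>E q \<in> {1..Q}. strategies (nT q) (pw q))"

definition others_strategies ::
  "nat \<Rightarrow> (nat \<Rightarrow> nat) \<Rightarrow> (nat \<Rightarrow> real) \<Rightarrow> nat \<Rightarrow> (nat \<Rightarrow> complex mat) set" where
  "others_strategies Q nT pw q = (\<Pi>\<^sub>E r \<in> {1..Q} - {q}. strategies (nT r) (pw r))"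

text \<open>Entrywise form of \<open>Rn q + (\<Sum>r \<noteq> q. H r q * X r * (H r q)\<^sup>H)\<close>; the type \<open>mat\<close> is not a monoid,
  so \<open>sum\<close> cannot be used on matrices directly.\<close>

definition interference_cov ::
  "nat \<Rightarrow> (nat \<Rightarrow> nat \<Rightarrow> complex mat) \<Rightarrow> (nat \<Rightarrow> complex mat) \<Rightarrow> nat \<Rightarrow>
   (nat \<Rightarrow> complex mat) \<Rightarrow> complex mat" where
  "interference_cov Q H Rn q X =
     mat (dim_row (Rn q)) (dim_col (Rn q)) (\<lambda>(i, j).
       Rn q $$ (i, j) + (\<Sum>r \<in> {1..Q} - {q}. (H r q * X r * mat_adjoint (H r q)) $$ (i, j)))"

text \<open>\<open>W\<close> is a waterfilling matrix for \<open>A\<close> with \<open>r\<close> positive eigenvalues \<open>d\<close>, water level \<open>\<mu>\<close> and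
  power \<open>p\<close>.\<close>

definition is_waterfilling :: "complex mat \<Rightarrow> nat \<Rightarrow> real \<Rightarrow> complex mat \<Rightarrow> bool" where
  "is_waterfilling A r p W \<longleftrightarrow>
     (\<exists>U d \<mu>. U \<in> carrier_mat (dim_row A) r \<and> mat_adjoint U * U = 1\<^sub>m r \<and> (\<forall>i<r. 0 < d i) \<and>
        A = U * mat_diag r (\<lambda>i. complex_of_real (d i)) * mat_adjoint U \<and>
        mat_tr (mat_diag r (\<lambda>i. complex_of_real (max 0 (\<mu> - 1 / d i)))) = complex_of_real p \<and>
        W = U * mat_diag r (\<lambda>i. complex_of_real (max 0 (\<mu> - 1 / d i))) * mat_adjoint U)"

text \<open>The eigendecomposition above is not unique, but for \<open>0 < p\<close> the resulting matrix does not depend on its choice.\<close>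

definition WF_user ::
  "nat \<Rightarrow> (nat \<Rightarrow> nat \<Rightarrow> complex mat) \<Rightarrow> (nat \<Rightarrow> complex mat) \<Rightarrow> (nat \<Rightarrow> real) \<Rightarrow> nat \<Rightarrow>
   (nat \<Rightarrow> complex mat) \<Rightarrow> complex mat" where
  "WF_user Q H Rn pw q X =
     (THE W. is_waterfilling
        (mat_adjoint (H q q) * mat_inv (interference_cov Q H Rn q X) * H q q)
        (mat_rank (H q q)) (pw q) W)"

definition WF ::
  "nat \<Rightarrow> (nat \<Rightarrow> nat \<Rightarrow> complex mat) \<Rightarrow> (nat \<Rightarrow> complex mat) \<Rightarrow> (nat \<Rightarrow> real) \<Rightarrow>
   (nat \<Rightarrow> complex mat) \<Rightarrow> nat \<Rightarrow> complex mat" where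
  "WF Q H Rn pw X =
     (\<lambda>q \<in> {1..Q}. WF_user Q H Rn pw q (restrict X ({1..Q} - {q})))"

definition gain :: "(nat \<Rightarrow> nat \<Rightarrow> complex mat) \<Rightarrow> nat \<Rightarrow> nat \<Rightarrow> complex mat \<Rightarrow> real" where
  "gain H r q P = spectral_radius
     (mat_adjoint (H r q) * mat_adjoint P * mat_adjoint (pinv (H q q)) * pinv (H q q) * P * H r q)"

text \<open>Row index \<open>q\<close> is the receiver, column index \<open>r\<close> the interferer, while projectors are indexed
  like channels, as \<open>P r q\<close>.\<close>

definition S_mat ::
  "(nat \<Rightarrow> nat \<Rightarrow> complex mat) \<Rightarrow> (nat \<Rightarrow> nat \<Rightarrow> complex mat) \<Rightarrow> nat \<Rightarrow> nat \<Rightarrow> real" where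
  "S_mat H P q r = (if r \<noteq> q then gain H r q (P r q) else 0)"

definition projector_feasible ::
  "nat \<Rightarrow> (nat \<Rightarrow> nat) \<Rightarrow> (nat \<Rightarrow> nat) \<Rightarrow> (nat \<Rightarrow> nat \<Rightarrow> complex mat) \<Rightarrow> (nat \<Rightarrow> complex mat) \<Rightarrow>
   (nat \<Rightarrow> real) \<Rightarrow> nat \<Rightarrow> complex mat \<times> (nat \<Rightarrow> complex mat) \<Rightarrow> bool" where
  "projector_feasible Q nT nR H Rn pw q = (\<lambda>(P, X).
     P \<in> carrier_mat (nR q) (nR q) \<and> X \<in> others_strategies Q nT pw q \<and>
     P = P * P \<and>
     mat_range P = mat_range (H q q) \<and>
     mat_kernel P = mat_kernel (mat_adjoint (H q q) * mat_inv (interference_cov Q H Rn q X)))"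

definition is_optimal_projector ::
  "nat \<Rightarrow> (nat \<Rightarrow> nat) \<Rightarrow> (nat \<Rightarrow> nat) \<Rightarrow> (nat \<Rightarrow> nat \<Rightarrow> complex mat) \<Rightarrow> (nat \<Rightarrow> complex mat) \<Rightarrow>
   (nat \<Rightarrow> real) \<Rightarrow> nat \<Rightarrow> nat \<Rightarrow> complex mat \<Rightarrow> bool" where
  "is_optimal_projector Q nT nR H Rn pw r q P \<longleftrightarrow>
     (\<exists>X. is_arg_max (\<lambda>(P', X'). gain H r q P') (projector_feasible Q nT nR H Rn pw q) (P, X))"

end

theory Submission
  imports Defs "HOL-Analysis.L2_Norm"
begin

text \<open>Write \<open>H\<close> for the direct channel of a user, \<open>\<Phi> = (H\<^sup>H R\<^sup>-\<^sup>1 H)\<^sup>-\<^sup>1\<close> and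
  \<open>G = \<Phi> H\<^sup>H R\<^sup>-\<^sup>1\<close>, so that \<open>G H = 1\<close>. The waterfilling matrix is the Frobenius projection of
  \<open>- \<Phi>\<close> onto the strategy set, hence it is a nonexpansive function of \<open>\<Phi>\<close>. Instead of the mean
  value theorem, the exact identity \<open>\<Phi>\<^sub>1 - \<Phi>\<^sub>2 = G\<^sub>1 (R\<^sub>1 - R\<^sub>2) G\<^sub>2\<^sup>H\<close> is used: expanding
  \<open>R\<^sub>1 - R\<^sub>2\<close> over the interferers, it bounds the Frobenius norm by the squared spectral norms of
  the matrices \<open>G H\<^sub>r\<^sub>q\<close>. Since \<open>G = H\<^sup>\<sharp> (H G)\<close> and \<open>H G\<close> is the oblique projector of the
  optimization problem, those are at most the entries of \<open>S(P\<^sup>\<star>)\<close>.\<close>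

section \<open>Adjoint and trace\<close>

text \<open>The exact identity involves only the two endpoints, at the price of two different
  factors \<open>G\<^sub>1\<close> and \<open>G\<^sub>2\<close>. Each of them contributes the square
  root of a spectral radius, so a common bound \<open>s\<close> for both radii yields the constant
  \<open>s\<close> itself; hence the entries of \<open>S_mat\<close> carry no square root. A common
  bound exists because the optimization ranges over the interferers' strategies together with the
  projector: one optimal value dominates the projectors of all strategy tuples.

  Full column rank enters twice. It makes \<open>H\<^sup>H R\<^sup>-\<^sup>1 H\<close> invertible,
  so that \<open>\<Phi>\<close> exists and the reduced eigendecomposition is a full one; and it
  gives \<open>H\<^sup>\<sharp> H = 1\<close>, which strips \<open>H\<close> from
  \<open>H G\<close>.

  Nonexpansiveness comes from first-order optimality of both waterfilling matrices. It is proved for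
  arbitrary eigendecompositions, so applying it to one matrix with two decompositions also gives the
  uniqueness that the definite description in \<open>WF_user\<close> needs.\<close>

lemma mat_adjoint_dim [simp]:
  "dim_row (mat_adjoint A) = dim_col A" "dim_col (mat_adjoint A) = dim_row A"
  by (simp_all add: mat_adjoint_def)

lemma mat_adjoint_carrier [simp]:
  "A \<in> carrier_mat n m \<Longrightarrow> mat_adjoint A \<in> carrier_mat m n"
  by (rule carrier_matI) auto

lemma mat_adjoint_index [simp]:
  "i < dim_col A \<Longrightarrow> j < dim_row A \<Longrightarrow> mat_adjoint A $$ (i, j) = conjugate (A $$ (j, i))"
  by (simp add: mat_adjoint_def mat_of_rows_def)

lemma mat_adjoint_adjoint [simp]: "mat_adjoint (mat_adjoint (A :: complex mat)) = A"
  by (rule eq_matI) auto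

lemma mat_adjoint_mult:
  fixes A B :: "complex mat"
  assumes "A \<in> carrier_mat n m" "B \<in> carrier_mat m k"
  shows "mat_adjoint (A * B) = mat_adjoint B * mat_adjoint A"
  using assms by (intro eq_matI) (auto simp: scalar_prod_def mult.commute intro!: sum.cong)

lemma mat_adjoint_minus:
  fixes A B :: "complex mat"
  assumes "A \<in> carrier_mat n m" "B \<in> carrier_mat n m"
  shows "mat_adjoint (A - B) = mat_adjoint A - mat_adjoint B"
  using assms by (intro eq_matI) auto

lemma mat_adjoint_one [simp]: "mat_adjoint (1\<^sub>m n :: complex mat) = 1\<^sub>m n"
  by (rule eq_matI) auto

lemma mat_adjoint_diag_real [simp]:
  "mat_adjoint (mat_diag n (\<lambda>i. complex_of_real (d i))) = mat_diag n (\<lambda>i. complex_of_real (d i))"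
  by (rule eq_matI) (auto simp: mat_diag_def)

lemma mat_tr_mult:
  assumes "A \<in> carrier_mat n m" "B \<in> carrier_mat m n"
  shows "mat_tr (A * B) = (\<Sum>i<n. \<Sum>j<m. A $$ (i, j) * B $$ (j, i))"
  using assms by (auto simp: mat_tr_def scalar_prod_def atLeast0LessThan intro!: sum.cong)

lemma mat_tr_comm:
  assumes "A \<in> carrier_mat n m" "B \<in> carrier_mat m n"
  shows "mat_tr (A * B) = mat_tr (B * A)"
  unfolding mat_tr_mult[OF assms] mat_tr_mult[OF assms(2,1)]
  by (subst sum.swap) (simp add: mult.commute)

lemma mat_tr_add:
  assumes "A \<in> carrier_mat n n" "B \<in> carrier_mat n n"
  shows "mat_tr (A + B) = mat_tr A + mat_tr B"
  using assms by (simp add: mat_tr_def sum.distrib)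

lemma mat_tr_minus:
  assumes "A \<in> carrier_mat n n" "B \<in> carrier_mat n n"
  shows "mat_tr (A - B) = mat_tr A - mat_tr B"
  using assms by (simp add: mat_tr_def sum_subtractf)

section \<open>Complex inner product and the adjoint\<close>

lemma cscalar_prod_sum:
  assumes "v \<in> carrier_vec n" "w \<in> carrier_vec n"
  shows "v \<bullet>c w = (\<Sum>i<n. v $ i * cnj (w $ i))"
  using assms by (auto simp: scalar_prod_def atLeast0LessThan intro!: sum.cong)

lemma cscalar_prod_self:
  assumes "v \<in> carrier_vec n"
  shows "v \<bullet>c v = complex_of_real (\<Sum>i<n. (cmod (v $ i))\<^sup>2)"
  unfolding cscalar_prod_sum[OF assms assms] of_real_sum
  by (simp only: complex_norm_square)

lemma cscalar_prod_commute:
  assumes "v \<in> carrier_vec n" "w \<in> carrier_vec n"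
  shows "v \<bullet>c w = cnj (w \<bullet>c v)"
  using assms by (simp add: cscalar_prod_sum mult.commute)

lemma cscalar_prod_adjoint:
  fixes A :: "complex mat"
  assumes "A \<in> carrier_mat n m" "v \<in> carrier_vec m" "w \<in> carrier_vec n"
  shows "(A *\<^sub>v v) \<bullet>c w = v \<bullet>c (mat_adjoint A *\<^sub>v w)"
proof -
  have "(A *\<^sub>v v) \<bullet>c w = (\<Sum>i<n. (\<Sum>j<m. A $$ (i, j) * v $ j) * cnj (w $ i))"
    using assms by (subst cscalar_prod_sum[of _ n])
      (auto simp: scalar_prod_def atLeast0LessThan intro!: sum.cong)
  also have "\<dots> = (\<Sum>j<m. v $ j * (\<Sum>i<n. A $$ (i, j) * cnj (w $ i)))"
    unfolding sum_distrib_left sum_distrib_right by (subst sum.swap) (simp add: ac_simps)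
  also have "\<dots> = v \<bullet>c (mat_adjoint A *\<^sub>v w)"
    using assms mult_mat_vec_carrier[OF mat_adjoint_carrier[OF assms(1)] assms(3)]
    by (subst cscalar_prod_sum[of _ m])
      (auto simp: scalar_prod_def atLeast0LessThan intro!: sum.cong)
  finally show ?thesis .
qed

lemma hermitian_cscalar_prod:
  fixes A :: "complex mat"
  assumes "A \<in> carrier_mat n n" "mat_adjoint A = A" "v \<in> carrier_vec n" "w \<in> carrier_vec n"
  shows "(A *\<^sub>v v) \<bullet>c w = v \<bullet>c (A *\<^sub>v w)"
  using cscalar_prod_adjoint[of A n n v w] assms by simp

lemma mat_mult_zero_vec: "A \<in> carrier_mat n m \<Longrightarrow> A *\<^sub>v 0\<^sub>v m = 0\<^sub>v n"
  by (intro eq_vecI) auto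

text \<open>A matrix with only zero eigenvalues has \<open>tr (N * N) = 0\<close>, as its Schur form
  shows; for Hermitian \<open>N\<close> this trace is the squared Frobenius norm, which is positive
  unless \<open>N\<close> vanishes.\<close>

lemma hermitian_nonzero_eigenvalue:
  fixes N :: "complex mat"
  assumes N: "N \<in> carrier_mat n n" and herm: "mat_adjoint N = N" and nz: "N \<noteq> 0\<^sub>m n n"
  obtains v c where "v \<in> carrier_vec n" "v \<noteq> 0\<^sub>v n" "c \<noteq> 0" "N *\<^sub>v v = c \<cdot>\<^sub>v v"
proof -
  obtain es where es: "char_poly N = (\<Prod>a\<leftarrow>es. [:- a, 1:])"
    using char_poly_factorized[OF N] by blast
  obtain B where B: "B \<in> carrier_mat n n" "upper_triangular B" "similar_mat N B"
    using schur_decomposition_exists[OF N es] by blast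
  from B(3) obtain P P' where PP: "similar_mat_wit N B P P'" unfolding similar_mat_def by blast
  note sim = similar_mat_witD2[OF N PP]
  have "mat_tr (N * N) = mat_tr (B * B)"
  proof -
    have "N * N = P * (B * (P' * P) * B * P')"
      unfolding sim(3) using sim(4-) by (simp add: assoc_mult_mat[of _ n n _ n _ n])
    also have "\<dots> = P * (B * B * P')" using sim by simp
    also have "mat_tr \<dots> = mat_tr (B * B * P' * P)"
      using sim by (subst mat_tr_comm[of _ n n]) auto
    also have "B * B * P' * P = B * B * (P' * P)"
      using sim by (simp add: assoc_mult_mat[of _ n n _ n _ n])
    finally show ?thesis using sim by simp
  qed
  moreover have "mat_tr (N * N) \<noteq> 0"
  proof
    assume "mat_tr (N * N) = 0"
    moreover have "mat_tr (N * N) = mat_tr (N * mat_adjoint N)" using herm by simp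
    moreover have "mat_tr (N * mat_adjoint N)
        = complex_of_real (\<Sum>i<n. \<Sum>j<n. (cmod (N $$ (i, j)))\<^sup>2)"
      using N by (subst mat_tr_mult[of _ n n]) (auto simp: complex_norm_square[symmetric] intro!: sum.cong)
    ultimately have "(\<Sum>i<n. \<Sum>j<n. (cmod (N $$ (i, j)))\<^sup>2) = 0"
      by (metis of_real_eq_0_iff)
    then have "\<forall>i<n. \<forall>j<n. N $$ (i, j) = 0"
      by (simp add: sum_nonneg_eq_0_iff sum_nonneg)
    then have "N = 0\<^sub>m n n" using N by (intro eq_matI) auto
    with nz show False by simp
  qed
  moreover have "mat_tr (B * B) = (\<Sum>i<n. (B $$ (i, i))\<^sup>2)"
  proof -
    \<comment> \<open>For distinct indices one of the two entries lies below the diagonal of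
      \<open>B\<close>.\<close>
    have "B $$ (i, j) * B $$ (j, i) = (if j = i then (B $$ (i, i))\<^sup>2 else 0)" if "i < n" "j < n" for i j
      using upper_triangularD[OF B(2), of i j] upper_triangularD[OF B(2), of j i] that B(1)
      by (cases i j rule: linorder_cases) (auto simp: power2_eq_square)
    then show ?thesis using B(1) by (subst mat_tr_mult[of _ n n]) auto
  qed
  ultimately obtain i where i: "i < n" "B $$ (i, i) \<noteq> 0"
    by (metis (no_types, lifting) lessThan_iff power_zero_numeral sum.neutral)
  have "poly (char_poly N) (B $$ (i, i)) = 0"
    unfolding char_poly_similar[OF B(3)] char_poly_upper_triangular[OF B(1,2)]
    using i B(1) by (auto simp: poly_prod_list prod_list_zero_iff diag_mat_def)
  then have "eigenvalue N (B $$ (i, i))" using eigenvalue_root_char_poly[OF N] by simp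
  then show ?thesis using that i(2) N unfolding eigenvalue_def eigenvector_def by auto
qed

section \<open>Spectral theorem for Hermitian matrices\<close>

text \<open>Singularity passes to the transpose through the determinant; conjugating a kernel vector
  of the transpose gives one of the adjoint.\<close>

lemma square_singular_adjoint:
  fixes M :: "complex mat"
  assumes M: "M \<in> carrier_mat n n" and x: "x \<in> carrier_vec n" "x \<noteq> 0\<^sub>v n" "M *\<^sub>v x = 0\<^sub>v n"
  obtains w where "w \<in> carrier_vec n" "w \<noteq> 0\<^sub>v n" "mat_adjoint M *\<^sub>v w = 0\<^sub>v n"
proof -
  have "det M = 0" using det_0_iff_vec_prod_zero_field[OF M] x by blast
  then have "det (transpose_mat M) = 0" using det_transpose[OF M] by simp
  then obtain y where y: "y \<in> carrier_vec n" "y \<noteq> 0\<^sub>v n" "transpose_mat M *\<^sub>v y = 0\<^sub>v n"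
    using det_0_iff_vec_prod_zero_field[of "transpose_mat M" n] M by auto
  have "mat_adjoint M *\<^sub>v conjugate y = conjugate (transpose_mat M *\<^sub>v y)"
    using M y(1) by (intro eq_vecI) (auto simp: scalar_prod_def)
  then have "mat_adjoint M *\<^sub>v conjugate y = 0\<^sub>v n" using y(3) by simp
  moreover have "conjugate y \<noteq> 0\<^sub>v n" using y(1,2) conjugate_zero_iff_vec[of y] by auto
  ultimately show ?thesis using that[of "conjugate y"] y(1) by simp
qed

lemma wide_adjoint_kernel:
  fixes U :: "complex mat"
  assumes U: "U \<in> carrier_mat n k" and k: "k < n"
  obtains w where "w \<in> carrier_vec n" "w \<noteq> 0\<^sub>v n" "mat_adjoint U *\<^sub>v w = 0\<^sub>v k"
proof -
  \<comment> \<open>Padding \<open>U\<close> with zero columns makes it square. Column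
    \<open>k\<close> exists because \<open>k < n\<close> and is zero, so \<open>M\<close> kills
    \<open>unit_vec n k\<close>; the first \<open>k\<close> coordinates of the adjoint of
    \<open>M\<close> applied to a vector are those given by the adjoint of \<open>U\<close>.\<close>
  define M where "M = mat n n (\<lambda>(i, j). if j < k then U $$ (i, j) else 0)"
  have M: "M \<in> carrier_mat n n" by (simp add: M_def)
  have "M *\<^sub>v unit_vec n k = 0\<^sub>v n"
    using k by (intro eq_vecI) (auto simp: M_def scalar_prod_right_unit)
  moreover have "unit_vec n k \<noteq> (0\<^sub>v n :: complex vec)"
    using k by (metis index_unit_vec(2) index_zero_vec(1) zero_neq_one)
  ultimately obtain w where w: "w \<in> carrier_vec n" "w \<noteq> 0\<^sub>v n" "mat_adjoint M *\<^sub>v w = 0\<^sub>v n"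
    using square_singular_adjoint[OF M, of "unit_vec n k"] by auto
  have "mat_adjoint U *\<^sub>v w = 0\<^sub>v k"
  proof (rule eq_vecI)
    fix i assume "i < dim_vec (0\<^sub>v k :: complex vec)"
    then have i: "i < k" by simp
    have "(mat_adjoint U *\<^sub>v w) $ i = (mat_adjoint M *\<^sub>v w) $ i"
      using U M w(1) i k by (auto simp: scalar_prod_def M_def intro!: sum.cong)
    then show "(mat_adjoint U *\<^sub>v w) $ i = 0\<^sub>v k $ i" using w(3) i k by simp
  qed (use U in auto)
  with w show ?thesis using that by blast
qed

text \<open>Bridge between the two views of an orthonormal system: the induction below extends a
  family of vectors, while the deflation step works with the matrix of its columns.\<close>

lemma orthonormal_columns:
  fixes v :: "nat \<Rightarrow> complex vec" and A :: "complex mat"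
  assumes v_all: "\<forall>i<k. v i \<in> carrier_vec n"
    and on_all: "\<forall>i<k. \<forall>j<k. v i \<bullet>c v j = (if i = j then 1 else 0)"
  defines "U \<equiv> mat n k (\<lambda>(a, i). v i $ a)"
  shows "U \<in> carrier_mat n k" "mat_adjoint U * U = 1\<^sub>m k"
    "\<And>i. i < k \<Longrightarrow> col U i = v i"
    "\<And>w i. w \<in> carrier_vec n \<Longrightarrow> i < k \<Longrightarrow> (mat_adjoint U *\<^sub>v w) $ i = w \<bullet>c v i"
proof -
  note v = v_all[rule_format] and on = on_all[rule_format]
  show U: "U \<in> carrier_mat n k" by (simp add: U_def)
  show col: "col U i = v i" if "i < k" for i
    using that v[OF that] by (intro eq_vecI) (auto simp: U_def)
  have "row (mat_adjoint U) i = conjugate (v i)" if "i < k" for i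
    using that v[OF that] by (intro eq_vecI) (auto simp: U_def)
  then show prod: "(mat_adjoint U *\<^sub>v w) $ i = w \<bullet>c v i" if "w \<in> carrier_vec n" "i < k" for w i
    using that U v[OF that(2)] comm_scalar_prod[of w n "conjugate (v i)"] by simp
  show "mat_adjoint U * U = 1\<^sub>m k"
  proof (rule eq_matI)
    fix i j assume "i < dim_row (1\<^sub>m k :: complex mat)" "j < dim_col (1\<^sub>m k :: complex mat)"
    then have ij: "i < k" "j < k" by auto
    have "(mat_adjoint U * U) $$ (i, j) = (mat_adjoint U *\<^sub>v col U j) $ i" using ij U by simp
    then show "(mat_adjoint U * U) $$ (i, j) = 1\<^sub>m k $$ (i, j)"
      using ij prod[OF v[OF ij(2)] ij(1)] on[OF ij(2,1)] col[OF ij(2)] by simp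
  qed (use U in auto)
qed

lemma eigenvector_columns:
  fixes A U :: "complex mat"
  assumes A: "A \<in> carrier_mat n n" and U: "U \<in> carrier_mat n k"
    and ev: "\<And>i. i < k \<Longrightarrow> A *\<^sub>v col U i = d i \<cdot>\<^sub>v col U i"
  shows "A * U = U * mat_diag k d"
proof (rule eq_matI)
  fix i j assume "i < dim_row (U * mat_diag k d)" "j < dim_col (U * mat_diag k d)"
  then have ij: "i < n" "j < k" using U by (auto simp: mat_diag_def)
  have "(A * U) $$ (i, j) = (A *\<^sub>v col U j) $ i" using ij A U by simp
  also have "\<dots> = U $$ (i, j) * d j" using ev[OF ij(2)] ij U by simp
  finally show "(A * U) $$ (i, j) = (U * mat_diag k d) $$ (i, j)"
    using ij U by (simp add: mat_diag_mult_right[OF U])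
qed (use A U in \<open>auto simp: mat_diag_def\<close>)

lemma hermitian_eigenvalue_real:
  fixes A :: "complex mat"
  assumes A: "A \<in> carrier_mat n n" "mat_adjoint A = A"
    and w: "w \<in> carrier_vec n" "w \<noteq> 0\<^sub>v n" "A *\<^sub>v w = c \<cdot>\<^sub>v w"
  shows "c = complex_of_real (Re c)"
proof -
  have "c * (w \<bullet>c w) = cnj c * (w \<bullet>c w)"
    using hermitian_cscalar_prod[OF A w(1,1)] w by (simp add: conjugate_smult_vec)
  moreover have "w \<bullet>c w \<noteq> 0" using w conjugate_square_eq_0_vec[OF w(1)] by simp
  ultimately have "cnj c = c" by simp
  then show ?thesis by (metis Reals_cnj_iff of_real_Re)
qed

text \<open>Deflation. \<open>N\<close> removes from \<open>A\<close> the part already diagonalized,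
  so that \<open>mat_adjoint U * N = 0\<close>, and \<open>N\<close> agrees with \<open>A\<close> on
  the orthogonal complement of the columns. If \<open>N\<close> is nonzero, an eigenvector for a
  nonzero eigenvalue lies in the range of \<open>N\<close> and is thus orthogonal to the columns. If
  \<open>N = 0\<close>, every vector of the complement is an eigenvector of \<open>A\<close> with
  eigenvalue 0.\<close>

lemma hermitian_eigenvector_orthogonal:
  fixes A U :: "complex mat"
  assumes A: "A \<in> carrier_mat n n" "mat_adjoint A = A"
    and U: "U \<in> carrier_mat n k" "mat_adjoint U * U = 1\<^sub>m k"
    and AU: "A * U = U * mat_diag k (\<lambda>i. complex_of_real (d i))" and k: "k < n"
  obtains w c where "w \<in> carrier_vec n" "w \<noteq> 0\<^sub>v n" "mat_adjoint U *\<^sub>v w = 0\<^sub>v k"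
    "A *\<^sub>v w = complex_of_real c \<cdot>\<^sub>v w"
proof -
  define D where "D = mat_diag k (\<lambda>i. complex_of_real (d i))"
  have D: "D \<in> carrier_mat k k" "mat_adjoint D = D" by (simp_all add: D_def)
  define N where "N = A - U * D * mat_adjoint U"
  have UH: "mat_adjoint U \<in> carrier_mat k n" using U by simp
  have UDU: "U * D * mat_adjoint U \<in> carrier_mat n n" using U D UH by (metis mult_carrier_mat)
  have N: "N \<in> carrier_mat n n" using A UDU unfolding N_def by (simp add: minus_carrier_mat)
  have "mat_adjoint (U * D * mat_adjoint U) = U * D * mat_adjoint U"
    using mat_adjoint_mult[OF mult_carrier_mat[OF U(1) D(1)] UH] mat_adjoint_mult[OF U(1) D(1)]
      assoc_mult_mat[OF U(1) D(1) UH] D(2) by simp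
  then have Nh: "mat_adjoint N = N"
    unfolding N_def using mat_adjoint_minus[OF A(1) UDU] A(2) by simp
  have "mat_adjoint U * A = mat_adjoint (A * U)"
    using mat_adjoint_mult[OF A(1) U(1)] A(2) by simp
  also have "\<dots> = D * mat_adjoint U" unfolding AU D_def[symmetric]
    using mat_adjoint_mult[OF U(1) D(1)] D(2) by simp
  finally have "mat_adjoint U * A = D * mat_adjoint U" .
  moreover have "mat_adjoint U * (U * D * mat_adjoint U) = (mat_adjoint U * U) * D * mat_adjoint U"
    using U(1) D(1) UH by (simp add: assoc_mult_mat[of _ k n _ k _ k]
        assoc_mult_mat[of _ k n _ k _ n] assoc_mult_mat[of _ n k _ k _ n] assoc_mult_mat[of _ k k _ k _ n])
  ultimately have UN: "mat_adjoint U * N = 0\<^sub>m k n"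
    unfolding N_def using mult_minus_distrib_mat[OF UH A(1) UDU] U(2) D(1) UH by simp
  have Aw: "A *\<^sub>v w = N *\<^sub>v w" if w: "w \<in> carrier_vec n" "mat_adjoint U *\<^sub>v w = 0\<^sub>v k" for w
  proof -
    have "(U * D * mat_adjoint U) *\<^sub>v w = (U * D) *\<^sub>v (mat_adjoint U *\<^sub>v w)"
      using U D UH w by (simp add: assoc_mult_mat_vec[of _ n k _ n])
    also have "\<dots> = 0\<^sub>v n"
      unfolding w(2) by (rule mat_mult_zero_vec[OF mult_carrier_mat[OF U(1) D(1)]])
    finally have "N *\<^sub>v w = A *\<^sub>v w - 0\<^sub>v n"
      unfolding N_def using minus_mult_distrib_mat_vec[OF A(1) UDU w(1)] by simp
    then show ?thesis using A w by auto
  qed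
  show ?thesis
  proof (cases "N = 0\<^sub>m n n")
    case True
    obtain w where w: "w \<in> carrier_vec n" "w \<noteq> 0\<^sub>v n" "mat_adjoint U *\<^sub>v w = 0\<^sub>v k"
      using wide_adjoint_kernel[OF U(1) k] by blast
    have "A *\<^sub>v w = complex_of_real 0 \<cdot>\<^sub>v w" using Aw[OF w(1,3)] True w(1) by auto
    with w show ?thesis using that by blast
  next
    case False
    obtain w c where w: "w \<in> carrier_vec n" "w \<noteq> 0\<^sub>v n" "c \<noteq> 0" "N *\<^sub>v w = c \<cdot>\<^sub>v w"
      using hermitian_nonzero_eigenvalue[OF N Nh False] by blast
    have "c \<cdot>\<^sub>v (mat_adjoint U *\<^sub>v w) = mat_adjoint U *\<^sub>v (N *\<^sub>v w)"
      unfolding w(4) using mult_mat_vec[OF UH w(1)] by simp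
    also have "\<dots> = (mat_adjoint U * N) *\<^sub>v w" using UH N w(1) by simp
    also have "\<dots> = 0\<^sub>v k" unfolding UN using w(1) by auto
    finally have "c \<cdot>\<^sub>v (mat_adjoint U *\<^sub>v w) = 0\<^sub>v k" .
    then have "(1/c) \<cdot>\<^sub>v (c \<cdot>\<^sub>v (mat_adjoint U *\<^sub>v w)) = 0\<^sub>v k" by auto
    then have U0: "mat_adjoint U *\<^sub>v w = 0\<^sub>v k" using w(3) by (simp add: smult_smult_assoc)
    show ?thesis using that[OF w(1,2) U0, of "Re c"]
      hermitian_eigenvalue_real[OF N Nh w(1,2,4)] Aw[OF w(1) U0] w(4) by simp
  qed
qed

text \<open>The induction is on the number of eigenvectors found while \<open>A\<close> stays fixed,
  so no restriction of \<open>A\<close> to a subspace has to be represented as a smaller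
  matrix.\<close>

lemma hermitian_orthonormal_eigenvectors:
  fixes A :: "complex mat"
  assumes A: "A \<in> carrier_mat n n" "mat_adjoint A = A" and k: "k \<le> n"
  shows "\<exists>v d. (\<forall>i<k. v i \<in> carrier_vec n \<and> A *\<^sub>v v i = complex_of_real (d i) \<cdot>\<^sub>v v i) \<and>
    (\<forall>i<k. \<forall>j<k. v i \<bullet>c v j = (if i = j then 1 else 0))"
  using k
proof (induction k)
  case 0
  then show ?case by simp
next
  case (Suc k)
  then obtain v d where v: "\<And>i. i < k \<Longrightarrow> v i \<in> carrier_vec n"
    and ev: "\<And>i. i < k \<Longrightarrow> A *\<^sub>v v i = complex_of_real (d i) \<cdot>\<^sub>v v i"
    and on: "\<And>i j. i < k \<Longrightarrow> j < k \<Longrightarrow> v i \<bullet>c v j = (if i = j then 1 else 0)"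
    by (metis Suc_leD)
  define U where "U = mat n k (\<lambda>(a, i). v i $ a)"
  have all: "\<forall>i<k. v i \<in> carrier_vec n" "\<forall>i<k. \<forall>j<k. v i \<bullet>c v j = (if i = j then 1 else 0)"
    using v on by simp_all
  note U = orthonormal_columns[OF all, folded U_def]
  have AU: "A * U = U * mat_diag k (\<lambda>i. complex_of_real (d i))"
    by (rule eigenvector_columns[OF A(1) U(1)]) (simp_all add: U(3) ev)
  obtain w c where w: "w \<in> carrier_vec n" "w \<noteq> 0\<^sub>v n" "mat_adjoint U *\<^sub>v w = 0\<^sub>v k"
    "A *\<^sub>v w = complex_of_real c \<cdot>\<^sub>v w"
    using hermitian_eigenvector_orthogonal[OF A U(1,2) AU] Suc.prems by (metis Suc_le_lessD)
  have wv: "w \<bullet>c v i = 0" if "i < k" for i using U(4)[OF w(1) that] w(3) that by simp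
  have vw: "v i \<bullet>c w = 0" if "i < k" for i
    using cscalar_prod_commute[OF v[OF that] w(1)] wv[OF that] by simp
  define s where "s = (\<Sum>i<n. (cmod (w $ i))\<^sup>2)"
  have ws: "w \<bullet>c w = complex_of_real s" using cscalar_prod_self[OF w(1)] by (simp add: s_def)
  moreover have "w \<bullet>c w \<noteq> 0" using w conjugate_square_eq_0_vec[OF w(1)] by simp
  moreover have "s \<ge> 0" by (simp add: s_def sum_nonneg)
  ultimately have s: "s > 0" by (cases "s = 0") auto
  define u where "u = complex_of_real (1 / sqrt s) \<cdot>\<^sub>v w"
  have u: "u \<in> carrier_vec n" using w by (simp add: u_def)
  have "complex_of_real (sqrt s) * complex_of_real (sqrt s) = complex_of_real s"
    using s by (metis less_eq_real_def of_real_mult real_sqrt_mult_self abs_of_nonneg)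
  then have uu: "u \<bullet>c u = 1"
    using w(1) ws s by (simp add: u_def conjugate_smult_vec field_simps)
  have uv: "u \<bullet>c v i = 0" "v i \<bullet>c u = 0" if "i < k" for i
    using w(1) v[OF that] wv[OF that] vw[OF that] by (simp_all add: u_def conjugate_smult_vec)
  have Au: "A *\<^sub>v u = complex_of_real c \<cdot>\<^sub>v u"
    using A(1) w by (simp add: u_def mult_mat_vec[of _ n n] smult_smult_assoc mult.commute)
  show ?case
  proof (intro exI[of _ "v(k := u)"] exI[of _ "d(k := c)"] conjI allI impI)
    fix i assume "i < Suc k"
    then show "(v(k := u)) i \<in> carrier_vec n"
      "A *\<^sub>v (v(k := u)) i = complex_of_real ((d(k := c)) i) \<cdot>\<^sub>v (v(k := u)) i"
      using v ev u Au by (auto simp: less_Suc_eq)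
  next
    fix i j assume "i < Suc k" "j < Suc k"
    then show "(v(k := u)) i \<bullet>c (v(k := u)) j = (if i = j then 1 else 0)"
      using on uu uv by (auto simp: less_Suc_eq)
  qed
qed

lemma hermitian_spectral_decomposition:
  fixes A :: "complex mat"
  assumes A: "A \<in> carrier_mat n n" "mat_adjoint A = A"
  obtains U d where "U \<in> carrier_mat n n" "mat_adjoint U * U = 1\<^sub>m n" "U * mat_adjoint U = 1\<^sub>m n"
    "A = U * mat_diag n (\<lambda>i. complex_of_real (d i)) * mat_adjoint U"
    "\<And>i. i < n \<Longrightarrow> col U i \<noteq> 0\<^sub>v n" "\<And>i. i < n \<Longrightarrow> A *\<^sub>v col U i = complex_of_real (d i) \<cdot>\<^sub>v col U i"
proof -
  obtain v d where v: "\<And>i. i < n \<Longrightarrow> v i \<in> carrier_vec n"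
    and ev: "\<And>i. i < n \<Longrightarrow> A *\<^sub>v v i = complex_of_real (d i) \<cdot>\<^sub>v v i"
    and on: "\<And>i j. i < n \<Longrightarrow> j < n \<Longrightarrow> v i \<bullet>c v j = (if i = j then 1 else 0)"
    using hermitian_orthonormal_eigenvectors[OF A order.refl] by blast
  define U where "U = mat n n (\<lambda>(a, i). v i $ a)"
  have all: "\<forall>i<n. v i \<in> carrier_vec n" "\<forall>i<n. \<forall>j<n. v i \<bullet>c v j = (if i = j then 1 else 0)"
    using v on by simp_all
  note U = orthonormal_columns[OF all, folded U_def]
  have UH: "mat_adjoint U \<in> carrier_mat n n" using U by simp
  have U1: "U * mat_adjoint U = 1\<^sub>m n" using mat_mult_left_right_inverse[OF UH U(1,2)] .
  have AU: "A * U = U * mat_diag n (\<lambda>i. complex_of_real (d i))"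
    by (rule eigenvector_columns[OF A(1) U(1)]) (simp_all add: U(3) ev)
  have "A = A * (U * mat_adjoint U)" using A U1 by simp
  also have "\<dots> = U * mat_diag n (\<lambda>i. complex_of_real (d i)) * mat_adjoint U"
    using AU A U(1) UH by (simp flip: assoc_mult_mat[of _ n n _ n _ n])
  finally have dec: "A = U * mat_diag n (\<lambda>i. complex_of_real (d i)) * mat_adjoint U" .
  have "col U i \<noteq> 0\<^sub>v n" if "i < n" for i
    using on[OF that that] U(3)[OF that] by auto
  then show ?thesis using that[OF U(1,2) U1 dec] ev U(3) by simp
qed

section \<open>Spectral radius and Frobenius norm\<close>

text \<open>Substitution \<open>y = mat_adjoint U *\<^sub>v v\<close> diagonalizes the form. No
  orthonormality is involved, so the same formula also serves the rectangular \<open>U\<close> of a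
  reduced decomposition.\<close>

lemma hermitian_quadratic_form:
  fixes U :: "complex mat"
  assumes U: "U \<in> carrier_mat n r" and v: "v \<in> carrier_vec n"
  shows "(U * mat_diag r (\<lambda>i. complex_of_real (e i)) * mat_adjoint U *\<^sub>v v) \<bullet>c v =
    complex_of_real (\<Sum>i<r. e i * (cmod ((mat_adjoint U *\<^sub>v v) $ i))\<^sup>2)"
proof -
  let ?D = "mat_diag r (\<lambda>i. complex_of_real (e i))"
  define y where "y = mat_adjoint U *\<^sub>v v"
  have y: "y \<in> carrier_vec r" using mult_mat_vec_carrier[OF mat_adjoint_carrier[OF U] v] by (simp add: y_def)
  have D: "?D \<in> carrier_mat r r" by simp
  have Dy: "?D *\<^sub>v y = vec r (\<lambda>i. complex_of_real (e i) * y $ i)"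
    using y by (intro eq_vecI) (auto simp: mat_diag_def scalar_prod_def if_distrib[of "\<lambda>x. x * _"] cong: if_cong)
  have "U * ?D * mat_adjoint U *\<^sub>v v = U *\<^sub>v (?D *\<^sub>v y)"
    using assoc_mult_mat_vec[OF mult_carrier_mat[OF U D] mat_adjoint_carrier[OF U] v]
      assoc_mult_mat_vec[OF U D y] by (simp add: y_def)
  then have "(U * ?D * mat_adjoint U *\<^sub>v v) \<bullet>c v = (?D *\<^sub>v y) \<bullet>c y"
    using cscalar_prod_adjoint[OF U _ v, of "?D *\<^sub>v y"] mult_mat_vec_carrier[OF D y] by (simp add: y_def)
  also have "\<dots> = (\<Sum>i<r. complex_of_real (e i * (cmod (y $ i))\<^sup>2))"
    unfolding Dy using y by (subst cscalar_prod_sum[of _ r])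
      (auto simp: complex_norm_square[symmetric] mult.assoc intro!: sum.cong)
  finally show ?thesis by (simp add: y_def)
qed

lemma isometry_norm:
  fixes U :: "complex mat"
  assumes U: "U \<in> carrier_mat n r" "U * mat_adjoint U = 1\<^sub>m n" and v: "v \<in> carrier_vec n"
  shows "(\<Sum>i<r. (cmod ((mat_adjoint U *\<^sub>v v) $ i))\<^sup>2) = Re (v \<bullet>c v)"
proof -
  have "U * mat_diag r (\<lambda>i. complex_of_real 1) * mat_adjoint U = 1\<^sub>m n" using U by simp
  then show ?thesis using hermitian_quadratic_form[OF U(1) v, of "\<lambda>_. 1"] v by simp
qed

text \<open>Rayleigh quotient bound: in an eigenbasis the form is a sum weighted by the real
  eigenvalues, each at most its modulus and hence at most the spectral radius. With
  \<open>0 < n\<close> the spectrum is nonempty, so that its maximum is meaningful.\<close>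

lemma spectral_radius_quadratic_bound:
  assumes A: "A \<in> carrier_mat n n" "mat_adjoint A = A" and n: "0 < n" and v: "v \<in> carrier_vec n"
  shows "Re ((A *\<^sub>v v) \<bullet>c v) \<le> spectral_radius A * Re (v \<bullet>c v)"
proof -
  obtain U d where U: "U \<in> carrier_mat n n" "U * mat_adjoint U = 1\<^sub>m n"
    "A = U * mat_diag n (\<lambda>i. complex_of_real (d i)) * mat_adjoint U"
    "\<And>i. i < n \<Longrightarrow> col U i \<noteq> 0\<^sub>v n" "\<And>i. i < n \<Longrightarrow> A *\<^sub>v col U i = complex_of_real (d i) \<cdot>\<^sub>v col U i"
    using hermitian_spectral_decomposition[OF A] by metis
  have d: "d i \<le> spectral_radius A" if i: "i < n" for i
  proof -
    have "eigenvalue A (complex_of_real (d i))"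
      unfolding eigenvalue_def eigenvector_def using U(1,4,5) i A(1) by (metis carrier_matD(1) col_carrier_vec)
    then have "cmod (complex_of_real (d i)) \<in> norm ` spectrum A" unfolding spectrum_def by blast
    from spectral_radius_mem_max(2)[OF A(1) n this] show ?thesis by simp
  qed
  have "Re ((A *\<^sub>v v) \<bullet>c v) = (\<Sum>i<n. d i * (cmod ((mat_adjoint U *\<^sub>v v) $ i))\<^sup>2)"
    using hermitian_quadratic_form[OF U(1) v, of d] U(3) by (metis Re_complex_of_real)
  also have "\<dots> \<le> (\<Sum>i<n. spectral_radius A * (cmod ((mat_adjoint U *\<^sub>v v) $ i))\<^sup>2)"
    using d by (intro sum_mono mult_right_mono) auto
  also have "\<dots> = spectral_radius A * Re (v \<bullet>c v)"
    using isometry_norm[OF U(1,2) v] by (simp flip: sum_distrib_left)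
  finally show ?thesis .
qed

lemma spectral_radius_nonneg:
  assumes "A \<in> carrier_mat n n" "0 < n"
  shows "0 \<le> spectral_radius A"
  using spectral_radius_mem_max(1)[OF assms] by auto

lemma frob_norm_nonneg [simp]: "0 \<le> frob_norm A"
  by (simp add: frob_norm_def sum_nonneg)

lemma frob_norm_sq: "(frob_norm A)\<^sup>2 = (\<Sum>i<dim_row A. \<Sum>j<dim_col A. (cmod (A $$ (i, j)))\<^sup>2)"
  by (simp add: frob_norm_def sum_nonneg)

lemma frob_norm_sq_cols:
  assumes "A \<in> carrier_mat n m"
  shows "(frob_norm A)\<^sup>2 = (\<Sum>j<m. Re (col A j \<bullet>c col A j))"
proof -
  have "(frob_norm A)\<^sup>2 = (\<Sum>j<m. \<Sum>i<n. (cmod (A $$ (i, j)))\<^sup>2)"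
    unfolding frob_norm_sq using assms by (subst sum.swap) auto
  also have "\<dots> = (\<Sum>j<m. Re (col A j \<bullet>c col A j))"
    using assms by (intro sum.cong refl) (subst cscalar_prod_self[of _ n], auto)
  finally show ?thesis .
qed

text \<open>Flattening a matrix to a vector of moduli reduces the triangle and Cauchy-Schwarz
  inequalities, and definiteness, to the facts about \<open>L2_set\<close>.\<close>

lemma frob_norm_L2_set:
  "frob_norm A = L2_set (\<lambda>x. cmod (A $$ x)) ({..<dim_row A} \<times> {..<dim_col A})"
  unfolding frob_norm_def L2_set_def by (simp add: sum.cartesian_product case_prod_unfold)

lemma frob_norm_add:
  assumes "A \<in> carrier_mat n m" "B \<in> carrier_mat n m"
  shows "frob_norm (A + B) \<le> frob_norm A + frob_norm B"
proof -
  let ?I = "{..<n} \<times> {..<m}"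
  have "frob_norm (A + B) \<le> L2_set (\<lambda>x. cmod (A $$ x) + cmod (B $$ x)) ?I"
    unfolding frob_norm_L2_set using assms
    by (auto intro!: L2_set_mono norm_triangle_ineq)
  also have "\<dots> \<le> frob_norm A + frob_norm B"
    unfolding frob_norm_L2_set using assms L2_set_triangle_ineq[of _ _ ?I] by auto
  finally show ?thesis .
qed

lemma frob_norm_adjoint [simp]: "frob_norm (mat_adjoint A) = frob_norm A"
  unfolding frob_norm_def by (subst sum.swap) (simp add: complex_mod_cnj)

lemma frob_norm_tr:
  assumes "A \<in> carrier_mat n m"
  shows "Re (mat_tr (A * mat_adjoint A)) = (frob_norm A)\<^sup>2"
  unfolding frob_norm_sq using assms
  by (subst mat_tr_mult[of _ n m]) (auto simp: complex_norm_square[symmetric] simp flip: of_real_power intro!: sum.cong)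

lemma frob_norm_cauchy_schwarz:
  assumes "A \<in> carrier_mat n m" "B \<in> carrier_mat n m"
  shows "\<bar>Re (mat_tr (A * mat_adjoint B))\<bar> \<le> frob_norm A * frob_norm B"
proof -
  let ?I = "{..<n} \<times> {..<m}"
  have "mat_tr (A * mat_adjoint B) = (\<Sum>(i, j)\<in>?I. A $$ (i, j) * cnj (B $$ (i, j)))"
    using assms by (subst mat_tr_mult[of _ n m]) (auto simp: sum.cartesian_product intro!: sum.cong)
  then have "cmod (mat_tr (A * mat_adjoint B)) \<le>
      (\<Sum>x\<in>?I. \<bar>cmod (A $$ x)\<bar> * \<bar>cmod (B $$ x)\<bar>)"
    by (auto intro!: order.trans[OF norm_sum] sum_mono simp: norm_mult)
  also have "\<dots> \<le> frob_norm A * frob_norm B"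
    unfolding frob_norm_L2_set using assms L2_set_mult_ineq[of "\<lambda>x. cmod (A $$ x)" "\<lambda>x. cmod (B $$ x)" ?I] by simp
  finally show ?thesis using abs_Re_le_cmod order.trans by blast
qed

lemma frob_norm_eq_0:
  assumes "A \<in> carrier_mat n m" "frob_norm A = 0"
  shows "A = 0\<^sub>m n m"
proof (rule eq_matI)
  have "\<forall>x\<in>{..<n} \<times> {..<m}. cmod (A $$ x) = 0"
    using assms L2_set_eq_0_iff[of "{..<n} \<times> {..<m}"] unfolding frob_norm_L2_set by auto
  then show "A $$ (i, j) = 0\<^sub>m n m $$ (i, j)" if "i < dim_row (0\<^sub>m n m)" "j < dim_col (0\<^sub>m n m)" for i j
    using that by auto
qed (use assms in auto)

text \<open>Column by column, the squared length of \<open>B *\<^sub>v y\<close> is the quadratic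
  form of \<open>mat_adjoint B * B\<close> at \<open>y\<close>, to which the Rayleigh bound
  applies.\<close>

lemma frob_norm_mult_left:
  fixes B Y :: "complex mat"
  assumes B: "B \<in> carrier_mat k n" and Y: "Y \<in> carrier_mat n m" and n: "0 < n"
  shows "frob_norm (B * Y) \<le> sqrt (spectral_radius (mat_adjoint B * B)) * frob_norm Y"
proof -
  let ?G = "mat_adjoint B * B"
  have G: "?G \<in> carrier_mat n n" using mult_carrier_mat[OF mat_adjoint_carrier[OF B] B] .
  have Gh: "mat_adjoint ?G = ?G" using B by (simp add: mat_adjoint_mult[of _ n k _ n])
  have "(frob_norm (B * Y))\<^sup>2 = (\<Sum>j<m. Re ((B *\<^sub>v col Y j) \<bullet>c (B *\<^sub>v col Y j)))"
    using frob_norm_sq_cols[OF mult_carrier_mat[OF B Y]] col_mult2[OF B Y] by simp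
  also have "\<dots> = (\<Sum>j<m. Re ((?G *\<^sub>v col Y j) \<bullet>c col Y j))"
  proof (rule sum.cong)
    fix j assume "j \<in> {..<m}"
    have c: "col Y j \<in> carrier_vec n" using Y by auto
    have Bc: "B *\<^sub>v col Y j \<in> carrier_vec k" using B c by simp
    have "(B *\<^sub>v col Y j) \<bullet>c (B *\<^sub>v col Y j) = col Y j \<bullet>c (?G *\<^sub>v col Y j)"
      using cscalar_prod_adjoint[OF B c Bc] assoc_mult_mat_vec[OF mat_adjoint_carrier[OF B] B c] by simp
    also have "\<dots> = (?G *\<^sub>v col Y j) \<bullet>c col Y j" using hermitian_cscalar_prod[OF G Gh c c] by simp
    finally show "Re ((B *\<^sub>v col Y j) \<bullet>c (B *\<^sub>v col Y j)) = Re ((?G *\<^sub>v col Y j) \<bullet>c col Y j)" by simp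
  qed simp
  also have "\<dots> \<le> (\<Sum>j<m. spectral_radius ?G * Re (col Y j \<bullet>c col Y j))"
    using Y by (intro sum_mono spectral_radius_quadratic_bound[OF G Gh n]) auto
  also have "\<dots> = spectral_radius ?G * (frob_norm Y)\<^sup>2"
    using frob_norm_sq_cols[OF Y] by (simp flip: sum_distrib_left)
  finally have "sqrt ((frob_norm (B * Y))\<^sup>2) \<le> sqrt (spectral_radius ?G * (frob_norm Y)\<^sup>2)"
    by (rule real_sqrt_le_mono)
  then show ?thesis by (simp add: real_sqrt_mult)
qed

text \<open>The two outer factors are allowed to differ because they will come from two different
  strategy tuples; each costs \<open>sqrt s\<close>.\<close>

lemma frob_norm_sandwich:
  fixes B C Y :: "complex mat"
  assumes B: "B \<in> carrier_mat k n" and C: "C \<in> carrier_mat k n" and Y: "Y \<in> carrier_mat n n"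
    and n: "0 < n" and s: "spectral_radius (mat_adjoint B * B) \<le> s" "spectral_radius (mat_adjoint C * C) \<le> s"
  shows "frob_norm (B * Y * mat_adjoint C) \<le> s * frob_norm Y"
proof -
  have s0: "0 \<le> s" using spectral_radius_nonneg[OF mult_carrier_mat[OF mat_adjoint_carrier[OF B] B] n] s by linarith
  have YC: "Y * mat_adjoint C \<in> carrier_mat n k" using Y C by simp
  have "frob_norm (B * Y * mat_adjoint C) = frob_norm (B * (Y * mat_adjoint C))"
    using assoc_mult_mat[OF B Y mat_adjoint_carrier[OF C]] by simp
  also have "\<dots> \<le> sqrt s * frob_norm (Y * mat_adjoint C)"
    using frob_norm_mult_left[OF B YC n] s(1)
    by (meson frob_norm_nonneg mult_right_mono order.trans real_sqrt_le_mono)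
  \<comment> \<open>Taking adjoints turns the right factor into a left one, so that the previous
    lemma covers it.\<close>
  also have "frob_norm (Y * mat_adjoint C) = frob_norm (C * mat_adjoint Y)"
    using mat_adjoint_mult[OF C mat_adjoint_carrier[OF Y]] frob_norm_adjoint[of "C * mat_adjoint Y"] by simp
  also have "sqrt s * \<dots> \<le> sqrt s * (sqrt s * frob_norm Y)"
    using frob_norm_mult_left[OF C mat_adjoint_carrier[OF Y] n] s(2) s0
    by (intro mult_left_mono) (auto intro: order.trans[OF _ mult_right_mono[OF real_sqrt_le_mono]])
  finally show ?thesis using s0 by (simp flip: mult.assoc)
qed

section \<open>Sums, inverses and pseudoinverses\<close>

text \<open>Entrywise like \<open>interference_cov\<close>, to which it is matched later. The
  explicit dimensions give the empty sum its size.\<close>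

definition mat_sum :: "nat \<Rightarrow> nat \<Rightarrow> ('i \<Rightarrow> complex mat) \<Rightarrow> 'i set \<Rightarrow> complex mat" where
  "mat_sum n m f S = mat n m (\<lambda>(i, j). \<Sum>r\<in>S. f r $$ (i, j))"

lemma mat_sum_carrier [simp]: "mat_sum n m f S \<in> carrier_mat n m"
  by (simp add: mat_sum_def)

lemma mat_sum_insert:
  assumes "finite S" "r \<notin> S" "f r \<in> carrier_mat n m"
  shows "mat_sum n m f (insert r S) = f r + mat_sum n m f S"
  using assms by (intro eq_matI) (auto simp: mat_sum_def)

lemma mat_sum_mult:
  assumes "finite S" and A: "A \<in> carrier_mat k n" and B: "B \<in> carrier_mat m l"
    and f: "\<And>r. r \<in> S \<Longrightarrow> f r \<in> carrier_mat n m"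
  shows "A * mat_sum n m f S * B = mat_sum k l (\<lambda>r. A * f r * B) S"
  using assms(1) f
proof (induction S)
  case empty
  have e: "mat_sum a b g {} = 0\<^sub>m a b" for a b and g :: "_ \<Rightarrow> complex mat"
    by (rule eq_matI) (auto simp: mat_sum_def)
  show ?case using A B by (simp add: e)
next
  case (insert r S)
  have fr: "f r \<in> carrier_mat n m" using insert.prems by simp
  have "A * mat_sum n m f (insert r S) * B = A * f r * B + A * mat_sum n m f S * B"
    unfolding mat_sum_insert[of S r f n m, OF insert.hyps fr]
    using mult_add_distrib_mat[OF A fr mat_sum_carrier[of n m f S]]
      add_mult_distrib_mat[OF mult_carrier_mat[OF A fr] mult_carrier_mat[OF A mat_sum_carrier[of n m f S]] B]
    by simp
  then show ?case
    using insert mult_carrier_mat[OF mult_carrier_mat[OF A fr] B] by (simp add: mat_sum_insert)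
qed

lemma frob_norm_mat_sum:
  assumes "finite S" "\<And>r. r \<in> S \<Longrightarrow> f r \<in> carrier_mat n m"
  shows "frob_norm (mat_sum n m f S) \<le> (\<Sum>r\<in>S. frob_norm (f r))"
  using assms
proof (induction S)
  case empty
  then show ?case by (simp add: mat_sum_def frob_norm_def)
next
  case (insert r S)
  have fr: "f r \<in> carrier_mat n m" using insert.prems by simp
  have "frob_norm (mat_sum n m f (insert r S)) \<le> frob_norm (f r) + frob_norm (mat_sum n m f S)"
    unfolding mat_sum_insert[of S r f n m, OF insert.hyps fr] using frob_norm_add[OF fr mat_sum_carrier] .
  then show ?case using insert by force
qed

section \<open>Inverses, positive definiteness and the pseudoinverse\<close>

lemma mat_inv_correct:
  fixes A :: "complex mat"
  assumes A: "A \<in> carrier_mat n n" and inj: "\<And>v. v \<in> carrier_vec n \<Longrightarrow> A *\<^sub>v v = 0\<^sub>v n \<Longrightarrow> v = 0\<^sub>v n"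
  shows "mat_inv A \<in> carrier_mat n n" "A * mat_inv A = 1\<^sub>m n" "mat_inv A * A = 1\<^sub>m n"
proof -
  have "det A \<noteq> 0" using det_0_iff_vec_prod_zero_field[OF A] inj by blast
  then obtain B where "mat_inverse A = Some B"
    using det_non_zero_imp_unit[OF A, where b = "()"] mat_inverse(1)[OF A, where b = "()"] by blast
  with mat_inverse(2)[OF A this]
  show "mat_inv A \<in> carrier_mat n n" "A * mat_inv A = 1\<^sub>m n" "mat_inv A * A = 1\<^sub>m n"
    by (simp_all add: mat_inv_def)
qed

lemma mat_right_inverse_unique:
  fixes A :: "complex mat"
  assumes "A \<in> carrier_mat n n" "B \<in> carrier_mat n n" "C \<in> carrier_mat n n"
    "B * A = 1\<^sub>m n" "A * C = 1\<^sub>m n"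
  shows "B = C"
  using assms assoc_mult_mat[of B n n A n C n] by simp

lemma hermitian_inverse:
  fixes A :: "complex mat"
  assumes "A \<in> carrier_mat n n" "mat_adjoint A = A" "B \<in> carrier_mat n n" "A * B = 1\<^sub>m n"
  shows "mat_adjoint B = B"
proof -
  have "mat_adjoint B * A = 1\<^sub>m n"
    using mat_adjoint_mult[OF assms(1,3)] assms by simp
  then show ?thesis using mat_right_inverse_unique[of A n "mat_adjoint B" B] assms by simp
qed

lemma pd_mat_hermitian: "pd_mat R \<Longrightarrow> mat_adjoint R = R"
  by (simp add: pd_mat_def hermitian_mat_def)

lemma pd_mat_kernel:
  assumes R: "R \<in> carrier_mat m m" "pd_mat R" and v: "v \<in> carrier_vec m" "R *\<^sub>v v = 0\<^sub>v m"
  shows "v = 0\<^sub>v m"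
  using assms unfolding pd_mat_def by force

lemma pd_mat_inv:
  assumes R: "R \<in> carrier_mat m m" "pd_mat R"
  shows "mat_inv R \<in> carrier_mat m m" "R * mat_inv R = 1\<^sub>m m" "mat_inv R * R = 1\<^sub>m m"
  using mat_inv_correct[OF R(1)] pd_mat_kernel[OF R] by blast+

lemma pd_mat_inverse_congruence:
  fixes H :: "complex mat"
  assumes R: "R \<in> carrier_mat m m" "pd_mat R" and H: "H \<in> carrier_mat m n"
    and inj: "\<And>v. v \<in> carrier_vec n \<Longrightarrow> H *\<^sub>v v = 0\<^sub>v m \<Longrightarrow> v = 0\<^sub>v n"
  shows "pd_mat (mat_adjoint H * mat_inv R * H)"
proof -
  note S = pd_mat_inv[OF R]
  have Sh: "mat_adjoint (mat_inv R) = mat_inv R"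
    using hermitian_inverse[OF R(1) pd_mat_hermitian[OF R(2)] S(1,2)] .
  let ?A = "mat_adjoint H * mat_inv R * H"
  have HS: "mat_adjoint H * mat_inv R \<in> carrier_mat n m"
    using mult_carrier_mat[OF mat_adjoint_carrier[OF H] S(1)] .
  have A: "?A \<in> carrier_mat n n" using mult_carrier_mat[OF HS H] .
  have "mat_adjoint ?A = mat_adjoint H * (mat_inv R * H)"
    using mat_adjoint_mult[OF HS H] mat_adjoint_mult[OF mat_adjoint_carrier[OF H] S(1)] Sh by simp
  then have Ah: "mat_adjoint ?A = ?A" using assoc_mult_mat[OF mat_adjoint_carrier[OF H] S(1) H] by simp
  have "0 < Re ((?A *\<^sub>v v) \<bullet>c v)" if v: "v \<in> carrier_vec n" "v \<noteq> 0\<^sub>v n" for v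
  proof -
    define y where "y = H *\<^sub>v v"
    define w where "w = mat_inv R *\<^sub>v y"
    have y: "y \<in> carrier_vec m" "y \<noteq> 0\<^sub>v m" using H v inj by (auto simp: y_def)
    have w: "w \<in> carrier_vec m" using S(1) y by (simp add: w_def)
    have Rw: "R *\<^sub>v w = y"
      unfolding w_def using assoc_mult_mat_vec[OF R(1) S(1) y(1)] S(2) y(1) by simp
    then have "w \<noteq> 0\<^sub>v m" using R(1) y(2) by auto
    then have pos: "0 < Re ((R *\<^sub>v w) \<bullet>c w)" using R w unfolding pd_mat_def by simp
    have "?A *\<^sub>v v = mat_adjoint H *\<^sub>v w"
      unfolding w_def y_def using assoc_mult_mat_vec[OF HS H v(1)]
        assoc_mult_mat_vec[OF mat_adjoint_carrier[OF H] S(1), of "H *\<^sub>v v"] H v by simp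
    then have "(?A *\<^sub>v v) \<bullet>c v = w \<bullet>c y"
      using cscalar_prod_adjoint[OF mat_adjoint_carrier[OF H] w v(1)] by (simp add: y_def)
    also have "\<dots> = cnj ((R *\<^sub>v w) \<bullet>c w)" unfolding Rw using cscalar_prod_commute[OF w y(1)] .
    finally show ?thesis using pos by simp
  qed
  then show ?thesis using A Ah unfolding pd_mat_def hermitian_mat_def by (metis carrier_matD(1))
qed

lemma full_rank_injective:
  fixes H :: "complex mat"
  assumes H: "H \<in> carrier_mat m n" and rank: "mat_rank H = n"
    and v: "v \<in> carrier_vec n" "H *\<^sub>v v = 0\<^sub>v m"
  shows "v = 0\<^sub>v n"
proof (rule ccontr)
  assume v0: "v \<noteq> 0\<^sub>v n"
  interpret vec_space "TYPE(complex)" m .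
  have rk: "rank H = n" using rank H by (simp add: mat_rank_def)
  \<comment> \<open>The rank is the size of a maximal independent subset of the set of columns. A
    repeated column would leave fewer than \<open>n\<close> vectors in that set, so rank
    \<open>n\<close> excludes it; only then does a nonzero kernel vector become a dependency of this
    set.\<close>
  have dist: "distinct (cols H)"
  proof (rule ccontr)
    assume nd: "\<not> distinct (cols H)"
    obtain S where S: "maximal S (\<lambda>T. T \<subseteq> set (cols H) \<and> lin_indpt T)"
      using maximal_exists[of "(\<lambda>T. T \<subseteq> set (cols H) \<and> lin_indpt T)" "card (set (cols H))" "{}"]
      by (meson List.finite_set card_mono empty_iff empty_subsetI finite_lin_indpt2 rev_finite_subset)
    then have "card S \<le> card (set (cols H))" by (simp add: card_mono maximal_def)
    also have "\<dots> < n" using nd H card_distinct[of "cols H"] card_length[of "cols H"] by fastforce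
    finally show False using rank_card_indpt[OF H S] rk by simp
  qed
  show False using lin_depI[OF H v(1) v0 v(2) dist] full_rank_lin_indpt[OF H rk dist] by simp
qed

text \<open>The candidate is \<open>(H\<^sup>H H)\<^sup>-\<^sup>1 H\<^sup>H\<close>. Existence and
  uniqueness are both shown, since \<open>pinv\<close> is a definite description.\<close>

lemma pinv_full_rank:
  fixes H :: "complex mat"
  assumes H: "H \<in> carrier_mat m n"
    and inj: "\<And>v. v \<in> carrier_vec n \<Longrightarrow> H *\<^sub>v v = 0\<^sub>v m \<Longrightarrow> v = 0\<^sub>v n"
  shows "pinv H \<in> carrier_mat n m" "pinv H * H = 1\<^sub>m n"
proof -
  let ?G = "mat_adjoint H * H"
  have HH: "mat_adjoint H \<in> carrier_mat n m" using H by simp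
  have G: "?G \<in> carrier_mat n n" using mult_carrier_mat[OF HH H] .
  have Gh: "mat_adjoint ?G = ?G" using mat_adjoint_mult[OF HH H] by simp
  have Ginj: "v = 0\<^sub>v n" if v: "v \<in> carrier_vec n" "?G *\<^sub>v v = 0\<^sub>v n" for v
  proof -
    have Hv: "H *\<^sub>v v \<in> carrier_vec m" using H v by simp
    have "(H *\<^sub>v v) \<bullet>c (H *\<^sub>v v) = v \<bullet>c (?G *\<^sub>v v)"
      using cscalar_prod_adjoint[OF H v(1) Hv] assoc_mult_mat_vec[OF HH H v(1)] by simp
    also have "\<dots> = 0" using v by simp
    finally have "H *\<^sub>v v = 0\<^sub>v m" using conjugate_square_eq_0_vec[OF Hv] by simp
    then show ?thesis using inj v by simp
  qed
  note K = mat_inv_correct[OF G Ginj]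
  let ?K = "mat_inv ?G"
  have Kh: "mat_adjoint ?K = ?K" using hermitian_inverse[OF G Gh K(1,2)] .
  let ?X = "?K * mat_adjoint H"
  have X: "?X \<in> carrier_mat n m" using mult_carrier_mat[OF K(1) HH] .
  have XH: "?X * H = 1\<^sub>m n" using assoc_mult_mat[OF K(1) HH H] K(3) by simp
  have HX: "mat_adjoint (H * ?X) = H * ?X"
    using mat_adjoint_mult[OF H X] mat_adjoint_mult[OF K(1) HH] Kh assoc_mult_mat[OF H K(1) HH] by simp
  have "is_pseudoinverse H ?X"
    unfolding is_pseudoinverse_def using H X XH HX assoc_mult_mat[OF H X H] left_mult_one_mat[OF X] by simp
  moreover have "Y = ?X" if Y: "is_pseudoinverse H Y" for Y
  proof -
    have Yc: "Y \<in> carrier_mat n m" and a: "H * Y * H = H" and b: "mat_adjoint (H * Y) = H * Y"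
      using Y H by (auto simp: is_pseudoinverse_def)
    have HY: "H * Y \<in> carrier_mat m m" using mult_carrier_mat[OF H Yc] .
    \<comment> \<open>Adjoint of \<open>H * Y * H = H\<close> with \<open>H * Y\<close> Hermitian:
      these are the normal equations, and they determine \<open>Y\<close>.\<close>
    have "mat_adjoint H = mat_adjoint H * (H * Y)"
      using mat_adjoint_mult[OF HY H] a b by simp
    also have "\<dots> = ?G * Y" using assoc_mult_mat[OF HH H Yc] by simp
    finally have "?X = ?K * (?G * Y)" by simp
    also have "\<dots> = Y" using assoc_mult_mat[OF K(1) G Yc] K(3) Yc by simp
    finally show ?thesis by simp
  qed
  ultimately have "pinv H = ?X" unfolding pinv_def by blast
  then show "pinv H \<in> carrier_mat n m" "pinv H * H = 1\<^sub>m n" using X XH by simp_all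
qed

section \<open>Calculus of matrices diagonal in a system of columns\<close>

lemma diag_conj_mult:
  fixes U :: "complex mat"
  assumes U: "U \<in> carrier_mat n r" "mat_adjoint U * U = 1\<^sub>m r"
  shows "(U * mat_diag r f * mat_adjoint U) * (U * mat_diag r g * mat_adjoint U)
    = U * mat_diag r (\<lambda>i. f i * g i) * mat_adjoint U"
proof -
  have UH: "mat_adjoint U \<in> carrier_mat r n" using U by simp
  have Uf: "U * mat_diag r f \<in> carrier_mat n r" using mult_carrier_mat[OF U(1) mat_diag_dim] .
  have gU: "mat_diag r g * mat_adjoint U \<in> carrier_mat r n" using mult_carrier_mat[OF mat_diag_dim UH] .
  have "mat_adjoint U * (U * mat_diag r g * mat_adjoint U) = mat_diag r g * mat_adjoint U"
    using assoc_mult_mat[OF U(1) mat_diag_dim UH] assoc_mult_mat[OF UH U(1) gU] U(2)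
      left_mult_one_mat[OF gU] by simp
  then have "(U * mat_diag r f * mat_adjoint U) * (U * mat_diag r g * mat_adjoint U)
      = U * mat_diag r f * (mat_diag r g * mat_adjoint U)"
    using assoc_mult_mat[OF Uf UH, of "U * mat_diag r g * mat_adjoint U" n] U(1) UH
      mult_carrier_mat[OF mult_carrier_mat[OF U(1) mat_diag_dim] UH] by simp
  also have "\<dots> = U * (mat_diag r f * mat_diag r g) * mat_adjoint U"
    using assoc_mult_mat[OF Uf mat_diag_dim UH] assoc_mult_mat[OF U(1) mat_diag_dim mat_diag_dim] by simp
  finally show ?thesis by simp
qed

lemma diag_conj_add:
  fixes U :: "complex mat"
  assumes U: "U \<in> carrier_mat n r"
  shows "U * mat_diag r f * mat_adjoint U + U * mat_diag r g * mat_adjoint U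
    = U * mat_diag r (\<lambda>i. f i + g i) * mat_adjoint U"
proof -
  have "U * mat_diag r (\<lambda>i. f i + g i) = U * mat_diag r f + U * mat_diag r g"
    using U by (intro eq_matI) (auto simp: mat_diag_mult_right[OF U] algebra_simps)
  then show ?thesis
    using add_mult_distrib_mat[OF mult_carrier_mat[OF U mat_diag_dim] mult_carrier_mat[OF U mat_diag_dim]
        mat_adjoint_carrier[OF U]] by simp
qed

text \<open>By cyclicity of the trace only the diagonal of \<open>Y\<close> in the coordinates given
  by \<open>U\<close> matters. This makes the trace inequality for waterfilling a scalar
  one.\<close>

lemma mat_tr_diag_conj:
  fixes U :: "complex mat"
  assumes U: "U \<in> carrier_mat n r" and Y: "Y \<in> carrier_mat n n"
  shows "mat_tr (U * mat_diag r f * mat_adjoint U * Y) = (\<Sum>i<r. f i * ((Y *\<^sub>v col U i) \<bullet>c col U i))"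
proof -
  have UH: "mat_adjoint U \<in> carrier_mat r n" using U by simp
  have UD: "U * mat_diag r f \<in> carrier_mat n r" using mult_carrier_mat[OF U mat_diag_dim] .
  have M: "mat_adjoint U * Y * U \<in> carrier_mat r r" using U UH Y by (metis mult_carrier_mat)
  have UY: "mat_adjoint U * Y \<in> carrier_mat r n" using mult_carrier_mat[OF UH Y] .
  have "mat_tr (U * mat_diag r f * mat_adjoint U * Y) = mat_tr (U * mat_diag r f * (mat_adjoint U * Y))"
    using assoc_mult_mat[OF UD UH Y] by simp
  also have "\<dots> = mat_tr (mat_adjoint U * Y * (U * mat_diag r f))" using mat_tr_comm[OF UD UY] .
  also have "\<dots> = mat_tr (mat_adjoint U * Y * U * mat_diag r f)"
    using assoc_mult_mat[OF UY U mat_diag_dim] by simp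
  also have "\<dots> = (\<Sum>i<r. f i * (mat_adjoint U * Y * U) $$ (i, i))"
    unfolding mat_diag_mult_right[OF M] by (simp add: mat_tr_def mult.commute)
  also have "\<dots> = (\<Sum>i<r. f i * ((Y *\<^sub>v col U i) \<bullet>c col U i))"
  proof (intro sum.cong refl arg_cong2[of _ _ _ _ "(*)"])
    fix i assume "i \<in> {..<r}"
    then have i: "i < r" by simp
    have c: "col U i \<in> carrier_vec n" using U by auto
    have r: "row (mat_adjoint U) i = conjugate (col U i)" using i U by (intro eq_vecI) auto
    have "(mat_adjoint U * (Y * U)) $$ (i, i) = conjugate (col U i) \<bullet> (Y *\<^sub>v col U i)"
      using i U UH Y r col_mult2[OF Y U i] by simp
    then have "(mat_adjoint U * Y * U) $$ (i, i) = conjugate (col U i) \<bullet> (Y *\<^sub>v col U i)"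
      unfolding assoc_mult_mat[OF UH Y U] .
    also have "\<dots> = (Y *\<^sub>v col U i) \<bullet>c col U i"
      using comm_scalar_prod[of "conjugate (col U i)" n "Y *\<^sub>v col U i"] c Y by simp
    finally show "(mat_adjoint U * Y * U) $$ (i, i) = (Y *\<^sub>v col U i) \<bullet>c col U i" .
  qed
  finally show ?thesis .
qed

section \<open>Waterfilling as a projection\<close>

lemma unitary_right:
  fixes U :: "complex mat"
  assumes "U \<in> carrier_mat n n" "mat_adjoint U * U = 1\<^sub>m n"
  shows "U * mat_adjoint U = 1\<^sub>m n"
  using mat_mult_left_right_inverse[OF mat_adjoint_carrier[OF assms(1)] assms] .

lemma mat_tr_diag: "mat_tr (mat_diag n f) = (\<Sum>i<n. f i)"
  by (simp add: mat_tr_def mat_diag_def)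

lemma diag_conj_carrier:
  fixes U :: "complex mat"
  assumes "U \<in> carrier_mat n r"
  shows "U * mat_diag r f * mat_adjoint U \<in> carrier_mat n n"
  using mult_carrier_mat[OF mult_carrier_mat[OF assms mat_diag_dim] mat_adjoint_carrier[OF assms]] .

lemma diag_conj_strategy:
  fixes U :: "complex mat"
  assumes U: "U \<in> carrier_mat n r" "mat_adjoint U * U = 1\<^sub>m r"
    and e: "\<And>i. i < r \<Longrightarrow> 0 \<le> e i" "(\<Sum>i<r. e i) = p"
  shows "U * mat_diag r (\<lambda>i. complex_of_real (e i)) * mat_adjoint U \<in> strategies n p"
proof -
  let ?D = "mat_diag r (\<lambda>i. complex_of_real (e i))"
  let ?W = "U * ?D * mat_adjoint U"
  have UH: "mat_adjoint U \<in> carrier_mat r n" using U by simp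
  have W: "?W \<in> carrier_mat n n" using diag_conj_carrier[OF U(1)] .
  have UD: "U * ?D \<in> carrier_mat n r" using mult_carrier_mat[OF U(1) mat_diag_dim] .
  have Wh: "mat_adjoint ?W = ?W"
    using mat_adjoint_mult[OF UD UH] mat_adjoint_mult[OF U(1) mat_diag_dim]
      assoc_mult_mat[OF U(1) mat_diag_dim UH] by simp
  have q: "0 \<le> Re ((?W *\<^sub>v v) \<bullet>c v)" if "v \<in> carrier_vec n" for v
    unfolding hermitian_quadratic_form[OF U(1) that] Re_complex_of_real
    using e by (intro sum_nonneg mult_nonneg_nonneg) auto
  have "mat_tr ?W = mat_tr (mat_adjoint U * (U * ?D))" using mat_tr_comm[OF UD UH] .
  also have "mat_adjoint U * (U * ?D) = ?D"
    unfolding assoc_mult_mat[OF UH U(1) mat_diag_dim, symmetric] U(2)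
    by (rule left_mult_one_mat[OF mat_diag_dim])
  finally have "mat_tr ?W = complex_of_real p" by (simp add: mat_tr_diag flip: e(2))
  then show ?thesis using W Wh q unfolding strategies_def psd_mat_def hermitian_mat_def by auto
qed

lemma waterfilling_strategy:
  assumes A: "A \<in> carrier_mat n n" and W: "is_waterfilling A r p W"
  shows "W \<in> strategies n p"
proof -
  obtain U d \<mu> where U: "U \<in> carrier_mat n r" "mat_adjoint U * U = 1\<^sub>m r"
    and tr: "mat_tr (mat_diag r (\<lambda>i. complex_of_real (max 0 (\<mu> - 1 / d i)))) = complex_of_real p"
    and Wd: "W = U * mat_diag r (\<lambda>i. complex_of_real (max 0 (\<mu> - 1 / d i))) * mat_adjoint U"
    using W A unfolding is_waterfilling_def by auto
  have "(\<Sum>i<r. max 0 (\<mu> - 1 / d i)) = p"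
    using tr unfolding mat_tr_diag of_real_sum[symmetric] of_real_eq_iff .
  then show ?thesis unfolding Wd by (intro diag_conj_strategy[OF U]) auto
qed

text \<open>First-order optimality of the waterfilling matrix as the Frobenius projection of
  \<open>- \<Phi>\<close> onto the strategy set: in the eigenbasis \<open>W + \<Phi>\<close> is diagonal with entries
  \<open>max \<mu> (1 / d i)\<close>, and \<open>W\<close> is supported where this equals its minimum \<open>\<mu>\<close>.\<close>

lemma waterfilling_variational:
  assumes A: "A \<in> carrier_mat n n" and W: "is_waterfilling A n p W"
    and \<Phi>: "\<Phi> \<in> carrier_mat n n" "A * \<Phi> = 1\<^sub>m n" and Y: "Y \<in> strategies n p"
  shows "0 \<le> Re (mat_tr ((W + \<Phi>) * (Y - W)))"
proof -
  obtain U d \<mu> where U: "U \<in> carrier_mat n n" "mat_adjoint U * U = 1\<^sub>m n"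
    and d: "\<And>i. i < n \<Longrightarrow> 0 < d i"
    and Ad: "A = U * mat_diag n (\<lambda>i. complex_of_real (d i)) * mat_adjoint U"
    and tr: "mat_tr (mat_diag n (\<lambda>i. complex_of_real (max 0 (\<mu> - 1 / d i)))) = complex_of_real p"
    and Wd: "W = U * mat_diag n (\<lambda>i. complex_of_real (max 0 (\<mu> - 1 / d i))) * mat_adjoint U"
    using W A unfolding is_waterfilling_def by auto
  have UU: "U * mat_adjoint U = 1\<^sub>m n" using unitary_right[OF U] .
  let ?w = "\<lambda>i. max 0 (\<mu> - 1 / d i)"
  let ?V = "U * mat_diag n (\<lambda>i. complex_of_real (1 / d i)) * mat_adjoint U"
  have V: "?V \<in> carrier_mat n n" using diag_conj_carrier[OF U(1)] .
  have Wc: "W \<in> carrier_mat n n" unfolding Wd using diag_conj_carrier[OF U(1)] .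
  have Yc: "Y \<in> carrier_mat n n" and Ypsd: "psd_mat Y" and Ytr: "mat_tr Y = complex_of_real p"
    using Y by (auto simp: strategies_def)
  have "?V * A = U * mat_diag n (\<lambda>i. complex_of_real (1 / d i) * complex_of_real (d i)) * mat_adjoint U"
    unfolding Ad using diag_conj_mult[OF U] .
  also have "mat_diag n (\<lambda>i. complex_of_real (1 / d i) * complex_of_real (d i)) = 1\<^sub>m n"
    using d by (intro eq_matI) (auto simp: mat_diag_def less_imp_neq[symmetric])
  finally have "?V * A = 1\<^sub>m n" using U UU by simp
  then have \<Phi>V: "\<Phi> = ?V" using mat_right_inverse_unique[OF A V \<Phi>(1)] \<Phi>(2) by simp
  let ?m = "\<lambda>i. max \<mu> (1 / d i)"
  have "W + \<Phi> = U * mat_diag n (\<lambda>i. complex_of_real (?w i) + complex_of_real (1 / d i)) * mat_adjoint U"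
    unfolding \<Phi>V Wd using diag_conj_add[OF U(1)] .
  also have "(\<lambda>i. complex_of_real (?w i) + complex_of_real (1 / d i)) = (\<lambda>i. complex_of_real (?m i))"
    by (auto simp: max_def)
  finally have sum: "W + \<Phi> = U * mat_diag n (\<lambda>i. complex_of_real (?m i)) * mat_adjoint U" .
  have trY: "mat_tr Y = (\<Sum>i<n. (Y *\<^sub>v col U i) \<bullet>c col U i)"
    using mat_tr_diag_conj[OF U(1) Yc, of "\<lambda>_. 1"] U(1) UU Yc by simp
  let ?y = "\<lambda>i. Re ((Y *\<^sub>v col U i) \<bullet>c col U i)"
  have "(\<Sum>i<n. ?y i) = Re (mat_tr Y)" unfolding trY by simp
  then have ysum: "(\<Sum>i<n. ?y i) = p" using Ytr by simp
  have ynn: "0 \<le> ?y i" for i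
    using Ypsd Yc U(1) unfolding psd_mat_def by auto
  have wsum: "(\<Sum>i<n. ?w i) = p"
    using tr unfolding mat_tr_diag of_real_sum[symmetric] of_real_eq_iff .
  \<comment> \<open>Both traces are compared with \<open>\<mu> * p\<close>: it is a lower bound for
    \<open>Y\<close>, whose diagonal is nonnegative with sum \<open>p\<close>, and the exact value
    for \<open>W\<close>, whose diagonal vanishes wherever \<open>?m i\<close> exceeds
    \<open>\<mu>\<close>.\<close>
  have "\<mu> * p = (\<Sum>i<n. \<mu> * ?y i)" using ysum by (simp flip: sum_distrib_left)
  also have "\<dots> \<le> (\<Sum>i<n. ?m i * ?y i)"
    using ynn by (intro sum_mono mult_right_mono) auto
  also have "\<dots> = Re (mat_tr ((W + \<Phi>) * Y))"
    unfolding sum mat_tr_diag_conj[OF U(1) Yc] by simp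
  finally have 1: "\<mu> * p \<le> Re (mat_tr ((W + \<Phi>) * Y))" .
  have "mat_tr ((W + \<Phi>) * W) = mat_tr (U * mat_diag n (\<lambda>i. complex_of_real (?m i) * complex_of_real (?w i)) * mat_adjoint U)"
    by (subst sum, subst Wd, subst diag_conj_mult[OF U], rule refl)
  also have "(\<lambda>i. complex_of_real (?m i) * complex_of_real (?w i)) = (\<lambda>i. complex_of_real (\<mu> * ?w i))"
    by (auto simp: max_def)
  also have "mat_tr (U * mat_diag n (\<lambda>i. complex_of_real (\<mu> * ?w i)) * mat_adjoint U)
      = mat_tr (mat_adjoint U * (U * mat_diag n (\<lambda>i. complex_of_real (\<mu> * ?w i))))"
    using mat_tr_comm[OF mult_carrier_mat[OF U(1) mat_diag_dim] mat_adjoint_carrier[OF U(1)]] .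
  also have "mat_adjoint U * (U * mat_diag n (\<lambda>i. complex_of_real (\<mu> * ?w i))) = mat_diag n (\<lambda>i. complex_of_real (\<mu> * ?w i))"
    unfolding assoc_mult_mat[OF mat_adjoint_carrier[OF U(1)] U(1) mat_diag_dim, symmetric] U(2)
    by (rule left_mult_one_mat[OF mat_diag_dim])
  also have "mat_tr \<dots> = complex_of_real (\<mu> * p)"
    unfolding mat_tr_diag of_real_sum[symmetric] using wsum by (simp flip: sum_distrib_left)
  finally have 2: "Re (mat_tr ((W + \<Phi>) * W)) = \<mu> * p" by simp
  have S: "W + \<Phi> \<in> carrier_mat n n" using Wc \<Phi> by simp
  have "mat_tr ((W + \<Phi>) * (Y - W)) = mat_tr ((W + \<Phi>) * Y) - mat_tr ((W + \<Phi>) * W)"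
    using mult_minus_distrib_mat[OF S Yc Wc] mat_tr_minus[OF mult_carrier_mat[OF S Yc] mult_carrier_mat[OF S Wc]] by simp
  with 1 2 show ?thesis by simp
qed

text \<open>Each matrix is tested in the other's variational inequality. Adding the two gives
  \<open>Re (mat_tr ((S\<^sub>1 - S\<^sub>2) * D)) \<le> 0\<close> for
  \<open>D = W\<^sub>1 - W\<^sub>2\<close>. Since \<open>S\<^sub>1 - S\<^sub>2\<close> is
  \<open>D\<close> plus the difference of the \<open>\<Phi>\<close>, the squared norm of
  \<open>D\<close> is bounded by an inner product, and Cauchy-Schwarz finishes.\<close>

lemma waterfilling_nonexpansive:
  assumes A: "A\<^sub>1 \<in> carrier_mat n n" "A\<^sub>2 \<in> carrier_mat n n"
    and W: "is_waterfilling A\<^sub>1 n p W\<^sub>1" "is_waterfilling A\<^sub>2 n p W\<^sub>2"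
    and \<Phi>: "\<Phi>\<^sub>1 \<in> carrier_mat n n" "A\<^sub>1 * \<Phi>\<^sub>1 = 1\<^sub>m n" "\<Phi>\<^sub>2 \<in> carrier_mat n n" "A\<^sub>2 * \<Phi>\<^sub>2 = 1\<^sub>m n"
  shows "frob_norm (W\<^sub>1 - W\<^sub>2) \<le> frob_norm (\<Phi>\<^sub>1 - \<Phi>\<^sub>2)"
proof -
  have st: "W\<^sub>1 \<in> strategies n p" "W\<^sub>2 \<in> strategies n p"
    using waterfilling_strategy A W by auto
  then have c: "W\<^sub>1 \<in> carrier_mat n n" "W\<^sub>2 \<in> carrier_mat n n"
    and h: "mat_adjoint W\<^sub>1 = W\<^sub>1" "mat_adjoint W\<^sub>2 = W\<^sub>2"
    by (auto simp: strategies_def psd_mat_def hermitian_mat_def)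
  let ?D = "W\<^sub>1 - W\<^sub>2"
  let ?E = "\<Phi>\<^sub>1 - \<Phi>\<^sub>2"
  have D: "?D \<in> carrier_mat n n" and E: "?E \<in> carrier_mat n n"
    using c \<Phi> by (simp_all add: minus_carrier_mat)
  have Dh: "mat_adjoint ?D = ?D" using mat_adjoint_minus[OF c] h by simp
  define S\<^sub>1 where "S\<^sub>1 = W\<^sub>1 + \<Phi>\<^sub>1"
  define S\<^sub>2 where "S\<^sub>2 = W\<^sub>2 + \<Phi>\<^sub>2"
  have S: "S\<^sub>1 \<in> carrier_mat n n" "S\<^sub>2 \<in> carrier_mat n n" using c \<Phi> by (simp_all add: S\<^sub>1_def S\<^sub>2_def)
  have 1: "0 \<le> Re (mat_tr (S\<^sub>1 * (W\<^sub>2 - W\<^sub>1)))"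
    using waterfilling_variational[OF A(1) W(1) \<Phi>(1,2) st(2)] by (simp add: S\<^sub>1_def)
  have 2: "0 \<le> Re (mat_tr (S\<^sub>2 * ?D))"
    using waterfilling_variational[OF A(2) W(2) \<Phi>(3,4) st(1)] by (simp add: S\<^sub>2_def)
  have "S\<^sub>1 * (W\<^sub>2 - W\<^sub>1) = S\<^sub>1 * W\<^sub>2 - S\<^sub>1 * W\<^sub>1" "S\<^sub>1 * ?D = S\<^sub>1 * W\<^sub>1 - S\<^sub>1 * W\<^sub>2"
    using mult_minus_distrib_mat S c by blast+
  then have 3: "mat_tr (S\<^sub>1 * (W\<^sub>2 - W\<^sub>1)) = - mat_tr (S\<^sub>1 * ?D)"
    using mat_tr_minus[of "S\<^sub>1 * W\<^sub>2" n "S\<^sub>1 * W\<^sub>1"] mat_tr_minus[of "S\<^sub>1 * W\<^sub>1" n "S\<^sub>1 * W\<^sub>2"]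
      mult_carrier_mat[OF S(1) c(1)] mult_carrier_mat[OF S(1) c(2)] by simp
  have "S\<^sub>1 - S\<^sub>2 = ?D + ?E"
    using c \<Phi>(1,3) by (intro eq_matI) (auto simp: S\<^sub>1_def S\<^sub>2_def)
  then have "(S\<^sub>1 - S\<^sub>2) * ?D = ?D * ?D + ?E * ?D" using add_mult_distrib_mat[OF D E D] by simp
  moreover have "(S\<^sub>1 - S\<^sub>2) * ?D = S\<^sub>1 * ?D - S\<^sub>2 * ?D" using minus_mult_distrib_mat[OF S D] .
  ultimately have "mat_tr (S\<^sub>1 * ?D) - mat_tr (S\<^sub>2 * ?D) = mat_tr (?D * ?D) + mat_tr (?E * ?D)"
    using mat_tr_minus[OF mult_carrier_mat[OF S(1) D] mult_carrier_mat[OF S(2) D]]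
      mat_tr_add[OF mult_carrier_mat[OF D D] mult_carrier_mat[OF E D]] by simp
  then have "Re (mat_tr (S\<^sub>1 * ?D)) - Re (mat_tr (S\<^sub>2 * ?D)) = Re (mat_tr (?D * ?D)) + Re (mat_tr (?E * ?D))"
    by (metis minus_complex.sel(1) plus_complex.sel(1))
  moreover have "Re (mat_tr (?D * ?D)) = (frob_norm ?D)\<^sup>2" using frob_norm_tr[OF D] Dh by simp
  moreover have "\<bar>Re (mat_tr (?E * ?D))\<bar> \<le> frob_norm ?E * frob_norm ?D"
    using frob_norm_cauchy_schwarz[OF E D] Dh by simp
  ultimately have "(frob_norm ?D)\<^sup>2 \<le> frob_norm ?E * frob_norm ?D" using 1 2 3 by simp
  then have "frob_norm ?D * frob_norm ?D \<le> frob_norm ?E * frob_norm ?D" by (simp add: power2_eq_square)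
  moreover have "0 \<le> frob_norm ?D" "0 \<le> frob_norm ?E" by simp_all
  ultimately show ?thesis by (cases "frob_norm ?D = 0") auto
qed

section \<open>Existence and uniqueness of the waterfilling matrix\<close>

lemma water_level_exists:
  fixes d :: "nat \<Rightarrow> real"
  assumes n: "0 < n" and d: "\<And>i. i < n \<Longrightarrow> 0 < d i" and p: "0 < p"
  obtains \<mu> where "(\<Sum>i<n. max 0 (\<mu> - 1 / d i)) = p"
proof -
  let ?f = "\<lambda>\<mu>. \<Sum>i<n. max 0 (\<mu> - 1 / d i)"
  have f0: "?f 0 = 0" using d by (intro sum.neutral) (force simp: max_def)
  \<comment> \<open>Right end of the interval for the intermediate value theorem: at level
    \<open>p + 1 / d 0\<close> the single channel 0 already absorbs the power \<open>p\<close>,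
    while at level 0 no channel gets any.\<close>
  have "p \<le> max 0 (p + 1 / d 0 - 1 / d 0)" by simp
  also have "\<dots> \<le> ?f (p + 1 / d 0)" using n by (intro member_le_sum) auto
  finally have f1: "p \<le> ?f (p + 1 / d 0)" .
  have "\<exists>\<mu>. 0 \<le> \<mu> \<and> \<mu> \<le> p + 1 / d 0 \<and> ?f \<mu> = p"
    using f0 f1 p d[OF n] by (intro IVT' continuous_intros) (auto simp: less_imp_le)
  then show ?thesis using that by blast
qed

lemma waterfilling_exists:
  assumes A: "A \<in> carrier_mat n n" "pd_mat A" and n: "0 < n" and p: "0 < p"
  shows "\<exists>W. is_waterfilling A n p W"
proof -
  obtain U d where U: "U \<in> carrier_mat n n" "mat_adjoint U * U = 1\<^sub>m n"
    "A = U * mat_diag n (\<lambda>i. complex_of_real (d i)) * mat_adjoint U"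
    and ev: "\<And>i. i < n \<Longrightarrow> col U i \<noteq> 0\<^sub>v n" "\<And>i. i < n \<Longrightarrow> A *\<^sub>v col U i = complex_of_real (d i) \<cdot>\<^sub>v col U i"
    using hermitian_spectral_decomposition[OF A(1) pd_mat_hermitian[OF A(2)]] by metis
  have d: "0 < d i" if i: "i < n" for i
  proof -
    have c: "col U i \<in> carrier_vec n" using U by auto
    have "0 < Re ((A *\<^sub>v col U i) \<bullet>c col U i)" using A c ev(1)[OF i] unfolding pd_mat_def by auto
    also have "(A *\<^sub>v col U i) \<bullet>c col U i = complex_of_real (d i) * (col U i \<bullet>c col U i)"
      using ev(2)[OF i] c by simp
    also have "Re \<dots> = d i * (\<Sum>j<n. (cmod (col U i $ j))\<^sup>2)" unfolding cscalar_prod_self[OF c] by simp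
    finally have "0 < d i * (\<Sum>j<n. (cmod (col U i $ j))\<^sup>2)" .
    moreover have "0 \<le> (\<Sum>j<n. (cmod (col U i $ j))\<^sup>2)" by (simp add: sum_nonneg)
    ultimately show ?thesis by (metis mult_nonpos_nonneg not_less)
  qed
  obtain \<mu> where \<mu>: "(\<Sum>i<n. max 0 (\<mu> - 1 / d i)) = p" using water_level_exists[of n d p, OF n d p] by blast
  have "mat_tr (mat_diag n (\<lambda>i. complex_of_real (max 0 (\<mu> - 1 / d i)))) = complex_of_real p"
    unfolding mat_tr_diag of_real_sum[symmetric] \<mu> ..
  then have "is_waterfilling A n p (U * mat_diag n (\<lambda>i. complex_of_real (max 0 (\<mu> - 1 / d i))) * mat_adjoint U)"
    unfolding is_waterfilling_def using U d A(1)
    by (intro exI[of _ U] exI[of _ d] exI[of _ \<mu>]) auto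
  then show ?thesis by blast
qed

text \<open>Uniqueness is nonexpansiveness with both arguments equal to \<open>A\<close>: the bound
  on the right is then the norm of the zero matrix, whichever decompositions and water levels were
  chosen.\<close>

lemma waterfilling_the:
  assumes A: "A \<in> carrier_mat n n" "pd_mat A" and n: "0 < n" and p: "0 < p"
  shows "is_waterfilling A n p (THE W. is_waterfilling A n p W)"
proof (rule theI')
  note I = pd_mat_inv[OF A]
  have "W = W'" if W: "is_waterfilling A n p W" "is_waterfilling A n p W'" for W W'
  proof -
    have c: "W \<in> carrier_mat n n" "W' \<in> carrier_mat n n"
      using waterfilling_strategy[OF A(1)] W by (auto simp: strategies_def)
    have "mat_inv A - mat_inv A = 0\<^sub>m n n" using I(1) by (intro eq_matI) auto
    moreover have "frob_norm (0\<^sub>m n n) = 0" by (simp add: frob_norm_def)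
    ultimately have "frob_norm (W - W') \<le> 0"
      using waterfilling_nonexpansive[OF A(1,1) W I(1,2) I(1,2)] by metis
    then have "frob_norm (W - W') = 0" by (rule antisym[OF _ frob_norm_nonneg])
    then have D: "W - W' = 0\<^sub>m n n" using c frob_norm_eq_0[of "W - W'" n n] by (simp add: minus_carrier_mat)
    show ?thesis
    proof (rule eq_matI)
      fix i j assume "i < dim_row W'" "j < dim_col W'"
      then have ij: "i < n" "j < n" using c by auto
      have "(W - W') $$ (i, j) = 0" using D ij by simp
      then show "W $$ (i, j) = W' $$ (i, j)" using ij c by simp
    qed (use c in auto)
  qed
  then show "\<exists>!W. is_waterfilling A n p W" using waterfilling_exists[OF A n p] by blast
qed

section \<open>Generalized least squares inverse\<close>

text \<open>The estimator of generalized least squares with noise covariance \<open>R\<close>: the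
  left inverse of \<open>H\<close> whose residual is orthogonal to the range of \<open>H\<close>
  with respect to \<open>mat_inv R\<close>.\<close>

definition gls_inverse :: "complex mat \<Rightarrow> complex mat \<Rightarrow> complex mat" where
  "gls_inverse H R = mat_inv (mat_adjoint H * mat_inv R * H) * (mat_adjoint H * mat_inv R)"

locale gls =
  fixes H R :: "complex mat" and m n :: nat
  assumes R: "R \<in> carrier_mat m m" "pd_mat R" and H: "H \<in> carrier_mat m n"
    and inj: "\<And>v. v \<in> carrier_vec n \<Longrightarrow> H *\<^sub>v v = 0\<^sub>v m \<Longrightarrow> v = 0\<^sub>v n"
begin

abbreviation "A \<equiv> mat_adjoint H * mat_inv R * H"
abbreviation "\<Phi> \<equiv> mat_inv A"
abbreviation "G \<equiv> gls_inverse H R"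

lemmas R_inv = pd_mat_inv[OF R]

lemma H_adj: "mat_adjoint H \<in> carrier_mat n m"
  using H by simp

lemma HS: "mat_adjoint H * mat_inv R \<in> carrier_mat n m"
  using mult_carrier_mat[OF H_adj R_inv(1)] .

lemma A_carrier: "A \<in> carrier_mat n n"
  using mult_carrier_mat[OF HS H] .

lemma A_pd: "pd_mat A"
  using pd_mat_inverse_congruence[OF R H inj] .

lemmas A_inv = pd_mat_inv[OF A_carrier A_pd]

lemma \<Phi>_hermitian: "mat_adjoint \<Phi> = \<Phi>"
  using hermitian_inverse[OF A_carrier pd_mat_hermitian[OF A_pd] A_inv(1,2)] .

lemma G_carrier: "G \<in> carrier_mat n m"
  unfolding gls_inverse_def using mult_carrier_mat[OF A_inv(1) HS] .

lemma G_left_inverse: "G * H = 1\<^sub>m n"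
  unfolding gls_inverse_def assoc_mult_mat[OF A_inv(1) HS H] using A_inv(3) .

lemma G_mult_R: "G * R = \<Phi> * mat_adjoint H"
  unfolding gls_inverse_def assoc_mult_mat[OF A_inv(1) HS R(1)] assoc_mult_mat[OF H_adj R_inv(1) R(1)] R_inv(3)
    right_mult_one_mat[OF H_adj] ..

lemma A_mult_G: "A * G = mat_adjoint H * mat_inv R"
  unfolding gls_inverse_def assoc_mult_mat[OF A_carrier A_inv(1) HS, symmetric] A_inv(2)
  using left_mult_one_mat[OF HS] .

lemma HG_carrier: "H * G \<in> carrier_mat m m"
  using mult_carrier_mat[OF H G_carrier] .

lemma HG_idempotent: "H * G = H * G * (H * G)"
  unfolding assoc_mult_mat[OF H G_carrier HG_carrier] assoc_mult_mat[OF G_carrier H G_carrier, symmetric]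
    G_left_inverse left_mult_one_mat[OF G_carrier] ..

lemma HG_range: "mat_range (H * G) = mat_range H"
proof
  show "mat_range (H * G) \<subseteq> mat_range H"
  proof
    fix x assume "x \<in> mat_range (H * G)"
    then obtain v where v: "v \<in> carrier_vec m" "x = H * G *\<^sub>v v"
      using HG_carrier by (auto simp: mat_range_def)
    then have "x = H *\<^sub>v (G *\<^sub>v v)" using assoc_mult_mat_vec[OF H G_carrier v(1)] by simp
    then show "x \<in> mat_range H"
      using mult_mat_vec_carrier[OF G_carrier v(1)] H unfolding mat_range_def by auto
  qed
next
  show "mat_range H \<subseteq> mat_range (H * G)"
  proof
    fix x assume "x \<in> mat_range H"
    then obtain v where v: "v \<in> carrier_vec n" "x = H *\<^sub>v v" using H by (auto simp: mat_range_def)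
    have Hv: "H *\<^sub>v v \<in> carrier_vec m" using H v by simp
    have "H * G *\<^sub>v (H *\<^sub>v v) = H *\<^sub>v (G *\<^sub>v (H *\<^sub>v v))" using assoc_mult_mat_vec[OF H G_carrier Hv] .
    also have "G *\<^sub>v (H *\<^sub>v v) = v"
      using assoc_mult_mat_vec[OF G_carrier H v(1)] G_left_inverse v(1) by simp
    finally have "x = H * G *\<^sub>v (H *\<^sub>v v)" using v(2) by simp
    then show "x \<in> mat_range (H * G)" using Hv G_carrier unfolding mat_range_def by auto
  qed
qed

text \<open>Both kernels equal that of \<open>G\<close>: on one side \<open>G\<close> is followed by
  the injective \<open>H\<close>, on the other by the invertible \<open>A\<close>, because
  \<open>A * G = mat_adjoint H * mat_inv R\<close>.\<close>

lemma HG_kernel: "mat_kernel (H * G) = mat_kernel (mat_adjoint H * mat_inv R)"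
proof -
  have "H * G *\<^sub>v v = 0\<^sub>v m \<longleftrightarrow> mat_adjoint H * mat_inv R *\<^sub>v v = 0\<^sub>v n" if v: "v \<in> carrier_vec m" for v
  proof -
    have Gv: "G *\<^sub>v v \<in> carrier_vec n" using G_carrier v by simp
    have "H * G *\<^sub>v v = H *\<^sub>v (G *\<^sub>v v)" using assoc_mult_mat_vec[OF H G_carrier v] .
    moreover have "mat_adjoint H * mat_inv R *\<^sub>v v = A *\<^sub>v (G *\<^sub>v v)"
      using assoc_mult_mat_vec[OF A_carrier G_carrier v] unfolding A_mult_G .
    moreover have "H *\<^sub>v 0\<^sub>v n = 0\<^sub>v m" "A *\<^sub>v 0\<^sub>v n = 0\<^sub>v n"
      using mat_mult_zero_vec[OF H] mat_mult_zero_vec[OF A_carrier] .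
    ultimately show ?thesis
      using inj[OF Gv] pd_mat_kernel[OF A_carrier A_pd Gv] by metis
  qed
  then show ?thesis unfolding mat_kernel[OF HG_carrier] mat_kernel[OF HS] by auto
qed

lemma pinv_H: "pinv H \<in> carrier_mat n m" "pinv H * H = 1\<^sub>m n"
  using pinv_full_rank[OF H] inj by blast+

lemma pinv_HG: "pinv H * (H * G) = G"
  unfolding assoc_mult_mat[OF pinv_H(1) H G_carrier, symmetric] pinv_H(2)
  using left_mult_one_mat[OF G_carrier] .

text \<open>The left side is the matrix inside \<open>gain\<close> for the projector
  \<open>H * G\<close>. Cancelling \<open>pinv H * H\<close> shows that this gain is the squared
  spectral norm of \<open>G * C\<close>, which is the quantity in
  \<open>frob_norm_sandwich\<close>.\<close>

lemma projected_gram: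
  assumes C: "C \<in> carrier_mat m k"
  shows "mat_adjoint C * mat_adjoint (H * G) * mat_adjoint (pinv H) * pinv H * (H * G) * C
    = mat_adjoint (G * C) * (G * C)"
proof -
  note K = pinv_H(1)
  have Ca: "mat_adjoint C \<in> carrier_mat k m" using C by simp
  have GC: "G * C \<in> carrier_mat n k" using mult_carrier_mat[OF G_carrier C] .
  have "mat_adjoint C * mat_adjoint (H * G) * mat_adjoint (pinv H)
      = mat_adjoint C * (mat_adjoint (H * G) * mat_adjoint (pinv H))"
    using assoc_mult_mat[OF Ca mat_adjoint_carrier[OF HG_carrier] mat_adjoint_carrier[OF K]] .
  also have "\<dots> = mat_adjoint (G * C)"
    unfolding mat_adjoint_mult[OF K HG_carrier, symmetric] pinv_HG
    using mat_adjoint_mult[OF G_carrier C] by simp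
  finally have 1: "mat_adjoint C * mat_adjoint (H * G) * mat_adjoint (pinv H) = mat_adjoint (G * C)" .
  show ?thesis
    unfolding 1 assoc_mult_mat[OF mat_adjoint_carrier[OF GC] K HG_carrier] pinv_HG
    using assoc_mult_mat[OF mat_adjoint_carrier[OF GC] G_carrier C] .
qed

end

text \<open>Both factors reproduce one of the two inverses: \<open>G\<^sub>1 R\<^sub>1 = \<Phi>\<^sub>1 H\<^sup>H\<close> and \<open>H\<^sup>H G\<^sub>2\<^sup>H = 1\<close>
  give \<open>G\<^sub>1 R\<^sub>1 G\<^sub>2\<^sup>H = \<Phi>\<^sub>1\<close>, and symmetrically \<open>G\<^sub>1 R\<^sub>2 G\<^sub>2\<^sup>H = \<Phi>\<^sub>2\<close>.\<close>

lemma gls_inverse_difference: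
  assumes g1: "gls H R\<^sub>1 m n" and g2: "gls H R\<^sub>2 m n"
  shows "mat_inv (mat_adjoint H * mat_inv R\<^sub>1 * H) - mat_inv (mat_adjoint H * mat_inv R\<^sub>2 * H)
    = gls_inverse H R\<^sub>1 * (R\<^sub>1 - R\<^sub>2) * mat_adjoint (gls_inverse H R\<^sub>2)"
proof -
  interpret g1: gls H R\<^sub>1 m n by fact
  interpret g2: gls H R\<^sub>2 m n by fact
  have Ga: "mat_adjoint g2.G \<in> carrier_mat m n" using g2.G_carrier by simp
  have "g1.G * R\<^sub>1 * mat_adjoint g2.G = g1.\<Phi> * (mat_adjoint H * mat_adjoint g2.G)"
    unfolding g1.G_mult_R using assoc_mult_mat[OF g1.A_inv(1) g1.H_adj Ga] .
  also have "mat_adjoint H * mat_adjoint g2.G = 1\<^sub>m n"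
    using mat_adjoint_mult[OF g2.G_carrier g2.H] g2.G_left_inverse by simp
  finally have 1: "g1.G * R\<^sub>1 * mat_adjoint g2.G = g1.\<Phi>" using g1.A_inv(1) by simp
  have "g1.G * R\<^sub>2 * mat_adjoint g2.G = g1.G * mat_adjoint (g2.G * R\<^sub>2)"
    using assoc_mult_mat[OF g1.G_carrier g2.R(1) Ga] mat_adjoint_mult[OF g2.G_carrier g2.R(1)]
      pd_mat_hermitian[OF g2.R(2)] by simp
  also have "mat_adjoint (g2.G * R\<^sub>2) = H * g2.\<Phi>"
    unfolding g2.G_mult_R using mat_adjoint_mult[OF g2.A_inv(1) g2.H_adj] g2.\<Phi>_hermitian by simp
  also have "g1.G * (H * g2.\<Phi>) = g2.\<Phi>"
    using assoc_mult_mat[OF g1.G_carrier g1.H g2.A_inv(1)] g1.G_left_inverse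
      left_mult_one_mat[OF g2.A_inv(1)] by simp
  finally have 2: "g1.G * R\<^sub>2 * mat_adjoint g2.G = g2.\<Phi>" .
  have "g1.G * (R\<^sub>1 - R\<^sub>2) * mat_adjoint g2.G = (g1.G * R\<^sub>1 - g1.G * R\<^sub>2) * mat_adjoint g2.G"
    unfolding mult_minus_distrib_mat[OF g1.G_carrier g1.R(1) g2.R(1)] ..
  also have "\<dots> = g1.G * R\<^sub>1 * mat_adjoint g2.G - g1.G * R\<^sub>2 * mat_adjoint g2.G"
    by (rule minus_mult_distrib_mat[OF mult_carrier_mat[OF g1.G_carrier g1.R(1)]
          mult_carrier_mat[OF g1.G_carrier g2.R(1)] Ga])
  finally show ?thesis unfolding 1 2 ..
qed

section \<open>Positive definiteness of noise plus interference\<close>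

lemma psd_mat_congruence:
  fixes B :: "complex mat"
  assumes B: "B \<in> carrier_mat m n" and Y: "Y \<in> carrier_mat n n" "psd_mat Y"
  shows "psd_mat (B * Y * mat_adjoint B)"
proof -
  let ?M = "B * Y * mat_adjoint B"
  have Ba: "mat_adjoint B \<in> carrier_mat n m" using B by simp
  have BY: "B * Y \<in> carrier_mat m n" using mult_carrier_mat[OF B Y(1)] .
  have M: "?M \<in> carrier_mat m m" using mult_carrier_mat[OF BY Ba] .
  have Yh: "mat_adjoint Y = Y" using Y by (simp add: psd_mat_def hermitian_mat_def)
  have Mh: "mat_adjoint ?M = ?M"
    using mat_adjoint_mult[OF BY Ba] mat_adjoint_mult[OF B Y(1)] Yh assoc_mult_mat[OF B Y(1) Ba] by simp
  have "0 \<le> Re ((?M *\<^sub>v v) \<bullet>c v)" if v: "v \<in> carrier_vec m" for v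
  proof -
    define y where "y = mat_adjoint B *\<^sub>v v"
    have y: "y \<in> carrier_vec n" using mult_mat_vec_carrier[OF Ba v] by (simp add: y_def)
    have Yy: "Y *\<^sub>v y \<in> carrier_vec n" using Y y by simp
    have "?M *\<^sub>v v = B *\<^sub>v (Y *\<^sub>v y)"
      unfolding y_def assoc_mult_mat_vec[OF BY Ba v] by (rule assoc_mult_mat_vec[OF B Y(1) y[unfolded y_def]])
    then have "(?M *\<^sub>v v) \<bullet>c v = (Y *\<^sub>v y) \<bullet>c y"
      using cscalar_prod_adjoint[OF B Yy v] by (simp add: y_def)
    then show ?thesis using Y y unfolding psd_mat_def by auto
  qed
  then show ?thesis using M Mh unfolding psd_mat_def hermitian_mat_def by auto
qed

lemma pd_mat_add_psd:
  assumes A: "A \<in> carrier_mat n n" "pd_mat A" and B: "B \<in> carrier_mat n n" "psd_mat B"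
  shows "pd_mat (A + B)"
proof -
  have "mat_adjoint (A + B) = mat_adjoint A + mat_adjoint B" using A(1) B(1) by (intro eq_matI) auto
  then have "mat_adjoint (A + B) = A + B"
    using A(2) B(2) by (simp add: pd_mat_def psd_mat_def hermitian_mat_def)
  moreover have "0 < Re (((A + B) *\<^sub>v v) \<bullet>c v)" if v: "v \<in> carrier_vec n" "v \<noteq> 0\<^sub>v n" for v
  proof -
    have "((A + B) *\<^sub>v v) \<bullet>c v = (A *\<^sub>v v) \<bullet>c v + (B *\<^sub>v v) \<bullet>c v"
      using add_mult_distrib_mat_vec[OF A(1) B(1) v(1)] A(1) B(1) v(1)
        add_scalar_prod_distrib[of "A *\<^sub>v v" n "B *\<^sub>v v" "conjugate v"] by simp
    moreover have "0 < Re ((A *\<^sub>v v) \<bullet>c v)" "0 \<le> Re ((B *\<^sub>v v) \<bullet>c v)"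
      using A B v unfolding pd_mat_def psd_mat_def by auto
    ultimately show ?thesis by simp
  qed
  ultimately show ?thesis using A(1) B(1) unfolding pd_mat_def hermitian_mat_def by auto
qed

lemma pd_mat_add_mat_sum:
  assumes "finite S" and A: "A \<in> carrier_mat n n" "pd_mat A"
    and f: "\<And>r. r \<in> S \<Longrightarrow> f r \<in> carrier_mat n n \<and> psd_mat (f r)"
  shows "pd_mat (A + mat_sum n n f S)"
  using assms(1) f
proof (induction S)
  case empty
  have "A + mat_sum n n f {} = A" using A by (intro eq_matI) (auto simp: mat_sum_def)
  then show ?case using A by simp
next
  case (insert r S)
  have fr: "f r \<in> carrier_mat n n" "psd_mat (f r)" using insert.prems by auto
  have "A + mat_sum n n f (insert r S) = (A + mat_sum n n f S) + f r"
    unfolding mat_sum_insert[of S r f n n, OF insert.hyps fr(1)]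
    using A(1) fr(1) by (intro eq_matI) (auto simp: mat_sum_def)
  moreover have "pd_mat ((A + mat_sum n n f S) + f r)"
    by (rule pd_mat_add_psd[OF add_carrier_mat[OF mat_sum_carrier] _ fr])
      (use insert in auto)
  ultimately show ?case by simp
qed

section \<open>Lipschitz continuity\<close>

locale mimo =
  fixes Q :: nat and nT nR :: "nat \<Rightarrow> nat" and H :: "nat \<Rightarrow> nat \<Rightarrow> complex mat"
    and Rn :: "nat \<Rightarrow> complex mat" and pw :: "nat \<Rightarrow> real"
  assumes dims: "\<And>q. q \<in> {1..Q} \<Longrightarrow> 0 < nT q \<and> 0 < nR q"
    and channel: "\<And>r q. r \<in> {1..Q} \<Longrightarrow> q \<in> {1..Q} \<Longrightarrow> H r q \<in> carrier_mat (nR q) (nT r)"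
    and noise: "\<And>q. q \<in> {1..Q} \<Longrightarrow> Rn q \<in> carrier_mat (nR q) (nR q) \<and> pd_mat (Rn q)"
    and power: "\<And>q. q \<in> {1..Q} \<Longrightarrow> 0 < pw q"
    and full_rank: "\<And>q. q \<in> {1..Q} \<Longrightarrow> mat_rank (H q q) = nT q"
begin

abbreviation "others q \<equiv> {1..Q} - {q}"
abbreviation "cov q X \<equiv> interference_cov Q H Rn q X"

lemma others_strategiesD:
  assumes "X \<in> others_strategies Q nT pw q" "r \<in> others q"
  shows "X r \<in> carrier_mat (nT r) (nT r)" "psd_mat (X r)"
  using assms by (auto simp: others_strategies_def strategies_def dest!: PiE_mem)

lemma interference_carrier:
  assumes q: "q \<in> {1..Q}" and r: "r \<in> others q" and Y: "Y \<in> carrier_mat (nT r) (nT r)"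
  shows "H r q * Y * mat_adjoint (H r q) \<in> carrier_mat (nR q) (nR q)"
proof -
  have C: "H r q \<in> carrier_mat (nR q) (nT r)" using channel q r by simp
  show ?thesis using mult_carrier_mat[OF mult_carrier_mat[OF C Y] mat_adjoint_carrier[OF C]] .
qed

lemma cov_gls:
  assumes q: "q \<in> {1..Q}" and X: "X \<in> others_strategies Q nT pw q"
  shows "gls (H q q) (cov q X) (nR q) (nT q)"
proof
  have C: "H r q \<in> carrier_mat (nR q) (nT r)" if "r \<in> others q" for r using channel q that by simp
  have N: "Rn q \<in> carrier_mat (nR q) (nR q)" "pd_mat (Rn q)" using noise[OF q] by auto
  let ?f = "\<lambda>r. H r q * X r * mat_adjoint (H r q)"
  have "cov q X = Rn q + mat_sum (nR q) (nR q) ?f (others q)"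
    using N(1) by (intro eq_matI) (auto simp: interference_cov_def mat_sum_def)
  moreover have "pd_mat (Rn q + mat_sum (nR q) (nR q) ?f (others q))"
    using interference_carrier[OF q] psd_mat_congruence[OF C] others_strategiesD[OF X]
    by (intro pd_mat_add_mat_sum[OF _ N]) auto
  ultimately show "pd_mat (cov q X)" by simp
  show "cov q X \<in> carrier_mat (nR q) (nR q)" using N(1) by (simp add: interference_cov_def)
  show "H q q \<in> carrier_mat (nR q) (nT q)" using channel q by simp
  then show "v = 0\<^sub>v (nT q)" if "v \<in> carrier_vec (nT q)" "H q q *\<^sub>v v = 0\<^sub>v (nR q)" for v
    using full_rank_injective[OF _ full_rank[OF q] that] by blast
qed

text \<open>The noise cancels and the covariance is affine in the strategies, so the change splits
  into one term per interferer.\<close>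

lemma cov_diff:
  assumes q: "q \<in> {1..Q}" and X: "X \<in> others_strategies Q nT pw q" "Y \<in> others_strategies Q nT pw q"
  shows "cov q X - cov q Y =
    mat_sum (nR q) (nR q) (\<lambda>r. H r q * (X r - Y r) * mat_adjoint (H r q)) (others q)"
proof -
  have N: "Rn q \<in> carrier_mat (nR q) (nR q)" using noise[OF q] by auto
  have "H r q * (X r - Y r) * mat_adjoint (H r q)
      = H r q * X r * mat_adjoint (H r q) - H r q * Y r * mat_adjoint (H r q)" if r: "r \<in> others q" for r
  proof -
    have C: "H r q \<in> carrier_mat (nR q) (nT r)" using channel q r by simp
    note x = others_strategiesD(1)[OF X(1) r] and y = others_strategiesD(1)[OF X(2) r]
    show ?thesis
      unfolding mult_minus_distrib_mat[OF C x y]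
      by (rule minus_mult_distrib_mat[OF mult_carrier_mat[OF C x] mult_carrier_mat[OF C y] mat_adjoint_carrier[OF C]])
  qed
  note d = this
  show ?thesis
  proof (rule eq_matI)
    fix i j assume "i < dim_row (mat_sum (nR q) (nR q) (\<lambda>r. H r q * (X r - Y r) * mat_adjoint (H r q)) (others q))"
      "j < dim_col (mat_sum (nR q) (nR q) (\<lambda>r. H r q * (X r - Y r) * mat_adjoint (H r q)) (others q))"
    then have ij: "i < nR q" "j < nR q" by (auto simp: mat_sum_def)
    have "(H r q * (X r - Y r) * mat_adjoint (H r q)) $$ (i, j)
      = (H r q * X r * mat_adjoint (H r q)) $$ (i, j) - (H r q * Y r * mat_adjoint (H r q)) $$ (i, j)"
      if r: "r \<in> others q" for r
      unfolding d[OF r]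
      using ij interference_carrier[OF q r others_strategiesD(1)[OF X(2) r]] by (intro index_minus_mat) auto
    then show "(cov q X - cov q Y) $$ (i, j) =
      mat_sum (nR q) (nR q) (\<lambda>r. H r q * (X r - Y r) * mat_adjoint (H r q)) (others q) $$ (i, j)"
      using ij N by (simp add: interference_cov_def mat_sum_def sum_subtractf)
  qed (use N in \<open>auto simp: interference_cov_def mat_sum_def\<close>)
qed

text \<open>For every \<open>X\<close> the pair of \<open>H q q * G\<close> and \<open>X\<close> is
  feasible, so the optimal value bounds its gain. \<open>X\<close> need not be the tuple attached to
  the optimizer \<open>P\<close>, which makes the bound uniform over the strategies.\<close>

lemma gain_bound:
  assumes q: "q \<in> {1..Q}" and r: "r \<in> others q" and X: "X \<in> others_strategies Q nT pw q"
    and opt: "is_optimal_projector Q nT nR H Rn pw r q P"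
  defines "B \<equiv> gls_inverse (H q q) (cov q X) * H r q"
  shows "spectral_radius (mat_adjoint B * B) \<le> gain H r q P"
proof -
  interpret g: gls "H q q" "cov q X" "nR q" "nT q" using cov_gls[OF q X] .
  have C: "H r q \<in> carrier_mat (nR q) (nT r)" using channel q r by simp
  have "projector_feasible Q nT nR H Rn pw q (H q q * g.G, X)"
    unfolding projector_feasible_def
    using g.HG_carrier X g.HG_idempotent g.HG_range g.HG_kernel by blast
  then have "gain H r q (H q q * g.G) \<le> gain H r q P"
    using opt unfolding is_optimal_projector_def is_arg_max_def by fastforce
  then show ?thesis unfolding gain_def g.projected_gram[OF C] B_def .
qed

abbreviation "WFq q X \<equiv> WF_user Q H Rn pw q X"

lemma WF_user_waterfilling:
  assumes q: "q \<in> {1..Q}" and X: "X \<in> others_strategies Q nT pw q"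
  shows "is_waterfilling (mat_adjoint (H q q) * mat_inv (cov q X) * H q q) (nT q) (pw q) (WFq q X)"
proof -
  interpret g: gls "H q q" "cov q X" "nR q" "nT q" using cov_gls[OF q X] .
  show ?thesis
    unfolding WF_user_def full_rank[OF q]
    using waterfilling_the[OF g.A_carrier g.A_pd] dims[OF q] power[OF q] by blast
qed

lemma WF_user_strategy:
  assumes q: "q \<in> {1..Q}" and X: "X \<in> others_strategies Q nT pw q"
  shows "WFq q X \<in> strategies (nT q) (pw q)"
proof -
  interpret g: gls "H q q" "cov q X" "nR q" "nT q" using cov_gls[OF q X] .
  show ?thesis using waterfilling_strategy[OF g.A_carrier WF_user_waterfilling[OF q X]] .
qed

lemma WF_user_lipschitz:
  assumes q: "q \<in> {1..Q}" and X: "X \<in> others_strategies Q nT pw q" "Y \<in> others_strategies Q nT pw q"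
    and opt: "\<And>r. r \<in> others q \<Longrightarrow> is_optimal_projector Q nT nR H Rn pw r q (P r q)"
  shows "frob_norm (WFq q X - WFq q Y) \<le> (\<Sum>r\<in>others q. gain H r q (P r q) * frob_norm (X r - Y r))"
proof -
  interpret g1: gls "H q q" "cov q X" "nR q" "nT q" using cov_gls[OF q X(1)] .
  interpret g2: gls "H q q" "cov q Y" "nR q" "nT q" using cov_gls[OF q X(2)] .
  let ?f = "\<lambda>r. H r q * (X r - Y r) * mat_adjoint (H r q)"
  have Ga: "mat_adjoint g2.G \<in> carrier_mat (nR q) (nT q)" using g2.G_carrier by simp
  have dc: "X r - Y r \<in> carrier_mat (nT r) (nT r)" if "r \<in> others q" for r
    using others_strategiesD(1)[OF X(2) that] by (rule minus_carrier_mat)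
  have f: "?f r \<in> carrier_mat (nR q) (nR q)" if "r \<in> others q" for r
    using interference_carrier[OF q that dc[OF that]] .
  have term_bound: "frob_norm (g1.G * ?f r * mat_adjoint g2.G) \<le> gain H r q (P r q) * frob_norm (X r - Y r)"
    if r: "r \<in> others q" for r
  proof -
    have C: "H r q \<in> carrier_mat (nR q) (nT r)" using channel q r by simp
    have Ca: "mat_adjoint (H r q) \<in> carrier_mat (nT r) (nR q)" using C by simp
    have B: "g1.G * H r q \<in> carrier_mat (nT q) (nT r)" "g2.G * H r q \<in> carrier_mat (nT q) (nT r)"
      using mult_carrier_mat[OF g1.G_carrier C] mult_carrier_mat[OF g2.G_carrier C] .
    \<comment> \<open>Regrouping absorbs the channel into both outer factors:
      \<open>G\<^sub>1 H\<^sub>r\<^sub>q\<close> on the left, the adjoint of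
      \<open>G\<^sub>2 H\<^sub>r\<^sub>q\<close> on the right. Both radii are below the same
      gain.\<close>
    have "g1.G * ?f r * mat_adjoint g2.G = g1.G * (H r q * (X r - Y r)) * mat_adjoint (H r q) * mat_adjoint g2.G"
      unfolding assoc_mult_mat[OF g1.G_carrier mult_carrier_mat[OF C dc[OF r]] Ca] ..
    also have "\<dots> = g1.G * (H r q * (X r - Y r)) * (mat_adjoint (H r q) * mat_adjoint g2.G)"
      by (rule assoc_mult_mat[OF mult_carrier_mat[OF g1.G_carrier mult_carrier_mat[OF C dc[OF r]]] Ca Ga])
    also have "\<dots> = (g1.G * H r q) * (X r - Y r) * mat_adjoint (g2.G * H r q)"
      unfolding mat_adjoint_mult[OF g2.G_carrier C] assoc_mult_mat[OF g1.G_carrier C dc[OF r]] ..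
    finally have e: "g1.G * ?f r * mat_adjoint g2.G = (g1.G * H r q) * (X r - Y r) * mat_adjoint (g2.G * H r q)" .
    have "0 < nT r" using dims r by simp
    then show ?thesis
      unfolding e using frob_norm_sandwich[OF B dc[OF r]] gain_bound[OF q r X(1) opt[OF r]]
        gain_bound[OF q r X(2) opt[OF r]] by blast
  qed
  have "frob_norm (WFq q X - WFq q Y) \<le> frob_norm (g1.\<Phi> - g2.\<Phi>)"
    using waterfilling_nonexpansive[OF g1.A_carrier g2.A_carrier WF_user_waterfilling[OF q X(1)]
        WF_user_waterfilling[OF q X(2)] g1.A_inv(1,2) g2.A_inv(1,2)] .
  also have "g1.\<Phi> - g2.\<Phi> = g1.G * (cov q X - cov q Y) * mat_adjoint g2.G"
    by (rule gls_inverse_difference[OF g1.gls_axioms g2.gls_axioms])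
  also have "\<dots> = mat_sum (nT q) (nT q) (\<lambda>r. g1.G * ?f r * mat_adjoint g2.G) (others q)"
    unfolding cov_diff[OF q X] by (rule mat_sum_mult[OF _ g1.G_carrier Ga f]) auto
  also have "frob_norm \<dots> \<le> (\<Sum>r\<in>others q. frob_norm (g1.G * ?f r * mat_adjoint g2.G))"
    using mult_carrier_mat[OF mult_carrier_mat[OF g1.G_carrier f] Ga] by (intro frob_norm_mat_sum) auto
  also have "\<dots> \<le> (\<Sum>r\<in>others q. gain H r q (P r q) * frob_norm (X r - Y r))"
    by (intro sum_mono term_bound)
  finally show ?thesis .
qed

lemma joint_restrict:
  assumes "X \<in> joint_strategies Q nT pw"
  shows "restrict X (others q) \<in> others_strategies Q nT pw q"
  using assms by (auto simp: joint_strategies_def others_strategies_def)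

lemma WF_joint: "WF Q H Rn pw \<in> joint_strategies Q nT pw \<rightarrow> joint_strategies Q nT pw"
  using WF_user_strategy joint_restrict
  by (auto simp: WF_def joint_strategies_def[of Q nT pw] joint_strategies_def[of Q nT pw, symmetric] simp del: restrict_apply)

text \<open>The usual passage from a componentwise bound to weighted maximum norms: each
  \<open>frob_norm (X r - Y r)\<close> is at most \<open>w r\<close> times the block norm, and what
  remains is a weighted row sum of \<open>S_mat\<close>.\<close>

lemma WF_lipschitz:
  assumes Q: "1 \<le> Q" and w: "\<forall>q \<in> {1..Q}. 0 < w q"
    and X: "X \<in> joint_strategies Q nT pw" "Y \<in> joint_strategies Q nT pw"
    and opt: "\<And>r q. r \<in> {1..Q} \<Longrightarrow> q \<in> {1..Q} \<Longrightarrow> r \<noteq> q \<Longrightarrow> is_optimal_projector Q nT nR H Rn pw r q (P r q)"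
  shows "block_norm Q w (\<lambda>q. WF Q H Rn pw X q - WF Q H Rn pw Y q)
    \<le> inf_mat_norm Q w (S_mat H P) * block_norm Q w (\<lambda>q. X q - Y q)"
proof -
  let ?S = "S_mat H P"
  let ?b = "block_norm Q w (\<lambda>q. X q - Y q)"
  have ne: "{1..Q} \<noteq> {}" using Q by simp
  have D: "frob_norm (X r - Y r) \<le> w r * ?b" if r: "r \<in> {1..Q}" for r
  proof -
    have "frob_norm (X r - Y r) / w r \<le> ?b" unfolding block_norm_def using r by (intro Max_ge) auto
    then show ?thesis using w r by (simp add: pos_divide_le_eq mult.commute)
  qed
  have b0: "0 \<le> ?b"
  proof -
    have "0 \<le> frob_norm (X 1 - Y 1) / w 1" using w Q by (simp add: less_imp_le)
    also have "\<dots> \<le> ?b" unfolding block_norm_def using Q by (intro Max_ge) auto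
    finally show ?thesis .
  qed
  have bound: "frob_norm (WF Q H Rn pw X q - WF Q H Rn pw Y q) / w q \<le> inf_mat_norm Q w ?S * ?b"
    if q: "q \<in> {1..Q}" for q
  proof -
    have wq: "0 < w q" using w q by simp
    let ?X = "restrict X (others q)" and ?Y = "restrict Y (others q)"
    have "frob_norm (WF Q H Rn pw X q - WF Q H Rn pw Y q) = frob_norm (WFq q ?X - WFq q ?Y)"
      using q by (simp add: WF_def)
    also have "\<dots> \<le> (\<Sum>r\<in>others q. gain H r q (P r q) * frob_norm (?X r - ?Y r))"
      using q opt by (intro WF_user_lipschitz joint_restrict X) auto
    also have "\<dots> = (\<Sum>r\<in>others q. ?S q r * frob_norm (X r - Y r))"
      by (intro sum.cong) (auto simp: S_mat_def)
    also have "\<dots> \<le> (\<Sum>r\<in>others q. \<bar>?S q r\<bar> * (w r * ?b))"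
      using D by (intro sum_mono mult_mono) auto
    \<comment> \<open>Readmits the index \<open>r = q\<close>, so that the sum becomes the full row
      sum of the matrix norm; its term is nonnegative.\<close>
    also have "\<dots> \<le> (\<Sum>r\<in>{1..Q}. \<bar>?S q r\<bar> * (w r * ?b))"
      using w b0 by (intro sum_mono2) (auto simp: less_imp_le)
    finally have "frob_norm (WF Q H Rn pw X q - WF Q H Rn pw Y q) / w q
        \<le> (\<Sum>r\<in>{1..Q}. \<bar>?S q r\<bar> * (w r * ?b)) / w q"
      using wq by (simp add: divide_right_mono)
    also have "\<dots> = ((1 / w q) * (\<Sum>r = 1..Q. \<bar>?S q r\<bar> * w r)) * ?b"
      by (simp add: sum_distrib_right mult.assoc)
    also have "\<dots> \<le> inf_mat_norm Q w ?S * ?b"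
      unfolding inf_mat_norm_def using q by (intro mult_right_mono[OF _ b0] Max_ge) auto
    finally show ?thesis .
  qed
  show ?thesis
    unfolding block_norm_def[of Q w "\<lambda>q. WF Q H Rn pw X q - WF Q H Rn pw Y q"]
    using bound ne by (subst Max_le_iff) auto
qed

end

text \<open>Supplies the condition \<open>0 \<le> \<beta>\<close> in
  \<open>block_contraction_on\<close>; row 1 witnesses it, which is where \<open>1 \<le> Q\<close>
  is used.\<close>

lemma inf_mat_norm_nonneg:
  assumes "1 \<le> Q" "\<forall>q \<in> {1..Q}. 0 < w q"
  shows "0 \<le> inf_mat_norm Q w A"
proof -
  have "0 \<le> (1 / w 1) * (\<Sum>r = 1..Q. \<bar>A 1 r\<bar> * w r)"
    using assms by (intro mult_nonneg_nonneg sum_nonneg) (auto simp: less_imp_le)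
  also have "\<dots> \<le> inf_mat_norm Q w A"
    unfolding inf_mat_norm_def using assms(1) by (intro Max_ge) auto
  finally show ?thesis .
qed

theorem theorem7:
  fixes Q :: nat
    and nT nR :: "nat \<Rightarrow> nat"
    and H :: "nat \<Rightarrow> nat \<Rightarrow> complex mat"
    and Rn :: "nat \<Rightarrow> complex mat"
    and pw :: "nat \<Rightarrow> real"
    and Pstar :: "nat \<Rightarrow> nat \<Rightarrow> complex mat"
  assumes "1 \<le> Q"
    and "\<And>q. q \<in> {1..Q} \<Longrightarrow> 0 < nT q \<and> 0 < nR q"
    and "\<And>r q. r \<in> {1..Q} \<Longrightarrow> q \<in> {1..Q} \<Longrightarrow> H r q \<in> carrier_mat (nR q) (nT r)"
    and "\<And>q. q \<in> {1..Q} \<Longrightarrow> Rn q \<in> carrier_mat (nR q) (nR q) \<and> pd_mat (Rn q)"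
    and "\<And>q. q \<in> {1..Q} \<Longrightarrow> 0 < pw q"
    and "\<And>q. q \<in> {1..Q} \<Longrightarrow> mat_rank (H q q) = nT q"
    and "\<And>r q. r \<in> {1..Q} \<Longrightarrow> q \<in> {1..Q} \<Longrightarrow> r \<noteq> q \<Longrightarrow>
           is_optimal_projector Q nT nR H Rn pw r q (Pstar r q)"
  shows "WF Q H Rn pw \<in> joint_strategies Q nT pw \<rightarrow> joint_strategies Q nT pw \<and>
    (\<forall>w. (\<forall>q \<in> {1..Q}. 0 < w q) \<longrightarrow>
       (\<forall>X1 \<in> joint_strategies Q nT pw. \<forall>X2 \<in> joint_strategies Q nT pw.
          block_norm Q w (\<lambda>q. WF Q H Rn pw X1 q - WF Q H Rn pw X2 q)
            \<le> inf_mat_norm Q w (S_mat H Pstar) * block_norm Q w (\<lambda>q. X1 q - X2 q))) \<and>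
    (\<forall>w. (\<forall>q \<in> {1..Q}. 0 < w q) \<longrightarrow> inf_mat_norm Q w (S_mat H Pstar) < 1 \<longrightarrow>
       block_contraction_on Q w (joint_strategies Q nT pw) (WF Q H Rn pw)
         (inf_mat_norm Q w (S_mat H Pstar)))"
proof -
  interpret mimo Q nT nR H Rn pw by unfold_locales (fact assms)+
  note lip = WF_lipschitz[OF assms(1) _ _ _ assms(7)]
  show ?thesis
    using WF_joint lip inf_mat_norm_nonneg[OF assms(1)] unfolding block_contraction_on_def by blast
qed

end
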